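(* Let $n\ge1$, $L=\operatorname{diag}(x^1,\dots,x^n)$, $g_{\mathsf{LC}}=\sum_{s}\bigl(\prod_{j\ne s}(x^s-x^j)\bigr)^{-1}(\partial/\partial x^s)^2$, and $P(t)=-4K(t-\mu_1)^{k_1}\cdots(t-\mu_m)^{k_m}$ with $K\neq0$, pairwise distinct (possibly complex) $\mu_i$ and $k_1+\dots+k_m=n+1$. Then the contravariant metric $g=P(L)g_{\mathsf{LC}}$ has constant curvature $K$, and the $n+1$ functions $Y_i^\alpha=\frac{1}{\alpha!}\frac{d^\alpha}{dt^\alpha}\sqrt{\det(t\operatorname{Id}-L)}\Big|_{t=\mu_i}$, $i=1,\dots,m$, $\alpha=0,\dots,k_i-1$ (any local branch of the square root), are linearly independent and satisfy $\nabla\nabla Y_i^\alpha+K\,Y_i^\alpha\,g=0$ (here $g$ is the covariant metric and $\nabla$ its Levi-Civita connection), i.e. they form generalised flat coordinates. More precisely, with $\tilde P_i(t)=\prod_{s\ne i}(t-\mu_s)^{k_s}$ and $\tilde P_i^{(k)}=\frac1{k!}\frac{d^k}{dt^k}\tilde P_i|_{t=\mu_i}$ ($=0$ for $k<0$): $g^*(dY_i^\alpha,dY_j^\beta)=-K\,Y_i^\alpha Y_j^\beta$ for $i\neq j$, and $g^*(dY_i^\alpha,dY_i^\beta)=-K\bigl(Y_i^\alpha Y_i^\beta-\tilde P_i^{(\alpha+\beta-k_i+1)}\bigr)$.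
   Context: $g^*$ denotes the contravariant metric applied to covectors. Generalised flat coordinates for a metric of constant nonzero curvature $K$ on an $n$-manifold are $n+1$ linearly independent functions $Y$ with $\nabla\nabla Y+KYg=0$. (The same conclusions hold with or without the factor $1/\alpha!$ in the definition of $Y_i^\alpha$, up to rescaling of the Gram matrix entries.) *)

theory Defs
  imports "HOL-Complex_Analysis.Complex_Analysis"
begin

text \<open>Coordinates x = (x^1,...,x^n) range over an open subset of real^'n (n = CARD('n));
  all tensor components are complex valued (the mu_i may be complex).\<close>

definition pd :: "'n::finite \<Rightarrow> (real^'n \<Rightarrow> complex) \<Rightarrow> real^'n \<Rightarrow> complex" where
  "pd i f x = vector_derivative (\<lambda>t::real. f (x + t *\<^sub>R axis i 1)) (at 0)"

text \<open>A metric is given by its contravariant components G x (a matrix g^{ab}(x)).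
  Covariant components g_ab are the inverse matrix.\<close>

definition gcov :: "(real^'n \<Rightarrow> complex^'n^'n) \<Rightarrow> 'n::finite \<Rightarrow> 'n \<Rightarrow> real^'n \<Rightarrow> complex" where
  "gcov G a b x = matrix_inv (G x) $ a $ b"

definition christoffel :: "(real^'n \<Rightarrow> complex^'n^'n) \<Rightarrow> 'n::finite \<Rightarrow> 'n \<Rightarrow> 'n \<Rightarrow> real^'n \<Rightarrow> complex" where
  "christoffel G c a b x = (1/2) * (\<Sum>d\<in>UNIV. G x $ c $ d *
      (pd a (gcov G d b) x + pd b (gcov G d a) x - pd d (gcov G a b) x))"

text \<open>Riemann tensor R^a_{bcd}, with R(d_c,d_d) d_b = R^a_{bcd} d_a.\<close>
definition riemann :: "(real^'n \<Rightarrow> complex^'n^'n) \<Rightarrow> 'n::finite \<Rightarrow> 'n \<Rightarrow> 'n \<Rightarrow> 'n \<Rightarrow> real^'n \<Rightarrow> complex" where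
  "riemann G a b c d x =
     pd c (christoffel G a d b) x - pd d (christoffel G a c b) x
     + (\<Sum>e\<in>UNIV. christoffel G a c e x * christoffel G e d b x
                 - christoffel G a d e x * christoffel G e c b x)"

text \<open>Constant curvature K: R(X,Y)Z = K (g(Y,Z) X - g(X,Z) Y).\<close>
definition const_curvature :: "(real^'n::finite) set \<Rightarrow> (real^'n \<Rightarrow> complex^'n^'n) \<Rightarrow> complex \<Rightarrow> bool" where
  "const_curvature U G K \<longleftrightarrow> (\<forall>x\<in>U. invertible (G x) \<and>
     (\<forall>a b c d. riemann G a b c d x =
        K * ((if a = c then 1 else 0) * gcov G d b x - (if a = d then 1 else 0) * gcov G c b x)))"

definition hess :: "(real^'n \<Rightarrow> complex^'n^'n) \<Rightarrow> (real^'n::finite \<Rightarrow> complex) \<Rightarrow> 'n \<Rightarrow> 'n \<Rightarrow> real^'n \<Rightarrow> complex" where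
  "hess G Y a b x = pd a (pd b Y) x - (\<Sum>c\<in>UNIV. christoffel G c a b x * pd c Y x)"

definition gstar :: "(real^'n \<Rightarrow> complex^'n^'n) \<Rightarrow> (real^'n::finite \<Rightarrow> complex) \<Rightarrow> (real^'n \<Rightarrow> complex) \<Rightarrow> real^'n \<Rightarrow> complex" where
  "gstar G Y Z x = (\<Sum>a\<in>UNIV. \<Sum>b\<in>UNIV. G x $ a $ b * pd a Y x * pd b Z x)"

definition gLC_P :: "(complex \<Rightarrow> complex) \<Rightarrow> real^'n::finite \<Rightarrow> complex^'n^'n" where
  "gLC_P P x = (\<chi> a b. if a = b then
      P (of_real (x $ a)) / (\<Prod>j\<in>UNIV - {a}. of_real (x $ a) - of_real (x $ j)) else 0)"

definition tildeP :: "nat \<Rightarrow> (nat \<Rightarrow> complex) \<Rightarrow> (nat \<Rightarrow> nat) \<Rightarrow> nat \<Rightarrow> int \<Rightarrow> complex" where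
  "tildeP m \<mu> k i r = (if r < 0 then 0 else
     ((deriv ^^ nat r) (\<lambda>t. \<Prod>s\<in>{..<m} - {i}. (t - \<mu> s) ^ k s) (\<mu> i)) / of_nat (fact (nat r)))"

end

theory Submission
  imports Defs
begin

text \<open>
  Write \<open>D(t) = det(t Id - L)\<close>, \<open>y = sqrt D\<close> and \<open>E_a = 1/(t - x^a)\<close>, all expanded as power series
  in \<open>t - \<mu>_i\<close>. Then \<open>\<partial>_a y = - y E_a / 2\<close> coefficientwise, and Lagrange interpolation gives
  \<open>P/D = d - 4 K t + (\<Sum>a. w_a E_a)\<close> with \<open>w_a = g^{aa}\<close>. Since \<open>y \<cdot> P/D = P/y\<close> vanishes to order
  \<open>k_i\<close> at \<open>\<mu>_i\<close>, comparing \<open>P/D\<close> at two arguments \<open>t\<close> and \<open>s\<close> computes the Gram matrix, and the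
  partial fraction expansion of \<open>E_a \<cdot> P/D\<close> is the diagonal part of the Hessian equation. The Gram matrix
  is block antitriangular up to the term \<open>- K Y Y\<close>, which yields linear independence. The differentials
  of the \<open>Y_i^\<alpha>\<close> span every cotangent space, because a linear relation would produce a nonzero polynomial
  of degree below \<open>n\<close> divisible by \<open>P\<close>; constant curvature is then the integrability condition of the
  Hessian equations.
\<close>

section \<open>Lagrange interpolation and Taylor expansion of polynomials\<close>

text \<open>Only germs at the \<mu>_i enter, so the work is done with formal power series in t -
  \<mu>_i: the coefficients of y are the Y_i^\<alpha>, complete with 1/\<alpha>!, and a claim for
  all \<alpha> < k_i is a congruence modulo the k_i-th power of the variable. Once the branch is
  expanded, only y * y = D and continuity in x of the constant coefficient are used; D(\<mu>_i)
  \<noteq> 0 makes y a unit. The obstacle is the Gram block i = j: there s - t has no constant term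
  and cannot be inverted, so y(t) y(s) (P/D(t) - P/D(s)) is divided by s - t explicitly. The
  quotient contributes the coefficient of P of index \<alpha> + \<beta> + 1, and the factor (t -
  \<mu>_i)^k_i of P turns this into the index \<alpha> + \<beta> - k_i + 1 for the remaining
  product. The 4 in P compensates the two factors -1/2 in g^*(dY, dY), as dY = - y E / 2. The
  constant d is never computed: it cancels in differences, and in the Hessian equation it is traded
  for P' at a node.\<close>

lemma lagrange_remainder:
  fixes p :: "'a::field poly" and z :: "'n::finite \<Rightarrow> 'a"
  assumes inj: "inj z" and deg: "degree p \<le> CARD('n) + 1"
  shows "\<exists>d. p = [:d, coeff p (CARD('n) + 1):] * (\<Prod>a\<in>UNIV. [:- z a, 1:]) +
    (\<Sum>a\<in>UNIV. smult (poly p (z a) / (\<Prod>j\<in>UNIV - {a}. z a - z j)) (\<Prod>j\<in>UNIV - {a}. [:- z j, 1:]))"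
proof -
  define n where "n = CARD('n)"
  define D where "D = (\<Prod>a\<in>UNIV. [:- z a, 1:])"
  define e where "e = coeff p (n + 1)"
  \<comment> \<open>\<open>D\<close> is monic of degree n, so subtracting e t D removes the term of
    degree n + 1 and leaves degree at most n.\<close>
  define p1 where "p1 = p - [:0, e:] * D"
  define d where "d = coeff p1 n"
  define R where "R = (\<Sum>a\<in>UNIV. smult (poly p (z a) / (\<Prod>j\<in>UNIV - {a}. z a - z j)) (\<Prod>j\<in>UNIV - {a}. [:- z j, 1:]))"
  have degprod: "degree (\<Prod>j\<in>S. [:- z j, 1:]) = card S" for S
    by (subst degree_prod_eq_sum_degree) auto
  have degD: "degree D = n"
    by (simp add: D_def degprod n_def)
  have lc: "coeff D n = 1"
    using lead_coeff_prod[of "\<lambda>a. [:- z a, 1:]" UNIV] degD by (simp add: D_def)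
  have Dz: "poly D (z a) = 0" for a
    by (simp add: D_def poly_prod prod_zero_iff) (metis diff_self)
  have degR: "degree R < n"
  proof -
    have "n > 0" by (simp add: n_def)
    have "degree R \<le> n - 1"
      unfolding R_def
      by (intro degree_sum_le order.trans[OF degree_smult_le]) (auto simp: degprod n_def card_Diff_singleton)
    with \<open>n > 0\<close> show ?thesis by linarith
  qed
  have Rz: "poly R (z b) = poly p (z b)" for b
  proof -
    have "poly R (z b) = (\<Sum>a\<in>UNIV. if a = b then poly p (z b) else 0)"
      unfolding R_def poly_sum
    proof (rule sum.cong)
      fix a
      show "poly (smult (poly p (z a) / (\<Prod>j\<in>UNIV - {a}. z a - z j)) (\<Prod>j\<in>UNIV - {a}. [:- z j, 1:])) (z b)
        = (if a = b then poly p (z b) else 0)"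
      proof (cases "a = b")
        case True
        have "(\<Prod>j\<in>UNIV - {b}. z b - z j) \<noteq> 0"
          using inj by (auto simp: inj_def)
        with True show ?thesis by (simp add: poly_prod)
      next
        case False
        then have "(\<Prod>j\<in>UNIV - {a}. z b - z j) = 0"
          by (auto intro!: prod_zero bexI[of _ b])
        with False show ?thesis by (simp add: poly_prod)
      qed
    qed simp
    then show ?thesis by simp
  qed
  have degp1: "degree p1 \<le> n"
  proof (rule degree_le, intro allI impI)
    fix i assume i: "n < i"
    have "coeff ([:0, e:] * D) i = e * coeff D (i - 1)"
      using i by (cases i) auto
    moreover have "coeff p i = (if i = n + 1 then e else 0)"
      using i deg by (auto simp: e_def n_def intro: coeff_eq_0)
    moreover have "coeff D (i - 1) = (if i = n + 1 then 1 else 0)"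
      using i degD lc by (auto intro: coeff_eq_0)
    ultimately show "coeff p1 i = 0" by (simp add: p1_def)
  qed
  \<comment> \<open>Two polynomials of degree at most n agree if they share the coefficient of
    degree n and n values; \<open>d\<close> was chosen to match that coefficient.\<close>
  have "p1 = smult d D + R"
  proof (rule poly_eqI_degree_lead_coeff[of _ n _ "range z"])
    show "coeff p1 n = coeff (smult d D + R) n"
      using degR lc by (simp add: d_def coeff_eq_0)
    show "card (range z) \<ge> n"
      using inj by (simp add: card_image n_def)
    show "degree (smult d D + R) \<le> n"
      using degR degD by (intro degree_add_le order.trans[OF degree_smult_le]) auto
    show "poly p1 y = poly (smult d D + R) y" if "y \<in> range z" for y
      using that Dz Rz by (auto simp: p1_def)
  qed (rule degp1)
  then have "p = [:d, e:] * D + R"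
    by (simp add: p1_def algebra_simps)
  then show ?thesis
    unfolding D_def R_def e_def n_def by blast
qed

section \<open>Taylor expansion at a point, as formal power series\<close>

definition taylor_poly :: "'a::comm_ring_1 \<Rightarrow> 'a poly \<Rightarrow> 'a fps" where
  "taylor_poly \<mu> p = fps_of_poly (pcompose p [:\<mu>, 1:])"

text \<open>With the formal variable read as t - \<mu>, this is the expansion of t - z, and
  \<open>recip_X\<close> below is that of 1/(t - z), a genuine inverse when \<mu> \<noteq> z. In
  particular \<open>shifted_X \<mu> 0\<close> is t itself.\<close>

definition shifted_X :: "'a::comm_ring_1 \<Rightarrow> 'a \<Rightarrow> 'a fps" where
  "shifted_X \<mu> z = fps_const (\<mu> - z) + fps_X"

definition recip_X :: "'a::field \<Rightarrow> 'a \<Rightarrow> 'a fps" where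
  "recip_X \<mu> z = inverse (shifted_X \<mu> z)"

lemma taylor_poly_mult: "taylor_poly \<mu> (p * q) = taylor_poly \<mu> p * taylor_poly \<mu> q"
  by (simp add: taylor_poly_def pcompose_mult fps_of_poly_mult)

lemma taylor_poly_add: "taylor_poly \<mu> (p + q) = taylor_poly \<mu> p + taylor_poly \<mu> q"
  by (simp add: taylor_poly_def pcompose_add fps_of_poly_add)

lemma taylor_poly_smult: "taylor_poly \<mu> (smult c p) = fps_const c * taylor_poly \<mu> p"
  by (simp add: taylor_poly_def pcompose_smult fps_of_poly_smult)

lemma taylor_poly_sum: "taylor_poly \<mu> (sum f A) = (\<Sum>a\<in>A. taylor_poly \<mu> (f a))"
  by (simp add: taylor_poly_def pcompose_sum fps_of_poly_sum)

lemma taylor_poly_prod: "taylor_poly \<mu> (prod f A) = (\<Prod>a\<in>A. taylor_poly \<mu> (f a))"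
  by (simp add: taylor_poly_def pcompose_prod fps_of_poly_prod)

lemma taylor_poly_power: "taylor_poly \<mu> (p ^ k) = taylor_poly \<mu> p ^ k"
  by (induction k) (simp_all add: taylor_poly_mult, simp add: taylor_poly_def pcompose_1)

lemma taylor_poly_linear: "taylor_poly \<mu> [:- z, 1:] = shifted_X \<mu> z"
  by (rule fps_ext)
     (auto simp: taylor_poly_def shifted_X_def pcompose_pCons coeff_pCons fps_X_def split: nat.splits)

lemma taylor_poly_linear':
  "taylor_poly \<mu> [:d, e:] = fps_const d + fps_const e * shifted_X \<mu> (0::'a::comm_ring_1)"
proof -
  have "[:d, e:] = [:d:] + smult e [:- 0, 1:]" by simp
  then show ?thesis
    by (simp only: taylor_poly_add taylor_poly_smult taylor_poly_linear)
       (simp add: taylor_poly_def fps_of_poly_const)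
qed

lemma recip_X_mult: "\<mu> \<noteq> z \<Longrightarrow> recip_X \<mu> z * shifted_X \<mu> z = 1"
  unfolding recip_X_def by (rule inverse_mult_eq_1) (simp add: shifted_X_def)

text \<open>The two linear factors differ by a constant. This single identity gives the off-diagonal
  Hessian equation and, summed over the nodes, the diagonal one.\<close>

lemma recip_X_partial_fraction:
  assumes "\<mu> \<noteq> z" "\<mu> \<noteq> w" "z \<noteq> w"
  shows "recip_X \<mu> z * recip_X \<mu> w = fps_const (inverse (z - w)) * (recip_X \<mu> z - recip_X \<mu> w)"
proof -
  have d: "shifted_X \<mu> w - shifted_X \<mu> z = fps_const (z - w)"
    by (simp add: shifted_X_def)
  have "recip_X \<mu> z - recip_X \<mu> w = (shifted_X \<mu> w * recip_X \<mu> w) * recip_X \<mu> z - (shifted_X \<mu> z * recip_X \<mu> z) * recip_X \<mu> w"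
    using recip_X_mult[OF assms(1)] recip_X_mult[OF assms(2)] by (simp add: mult.commute)
  also have "\<dots> = recip_X \<mu> z * recip_X \<mu> w * (shifted_X \<mu> w - shifted_X \<mu> z)"
    by (simp add: algebra_simps)
  finally have *: "recip_X \<mu> z - recip_X \<mu> w = recip_X \<mu> z * recip_X \<mu> w * fps_const (z - w)"
    by (simp add: d)
  have "fps_const (inverse (z - w)) * fps_const (z - w) = 1"
    using assms by simp
  then show ?thesis unfolding * by (metis mult.assoc mult.commute mult.right_neutral)
qed

section \<open>Bivariate power series\<close>

text \<open>\<open>fps_const\<close> and \<open>fps_snd\<close> embed power series in \<open>u\<close> and in \<open>v\<close>
  into the ring of power series in \<open>v\<close> whose coefficients are power series in \<open>u\<close>.\<close>

definition fps_snd :: "'a::comm_ring_1 fps \<Rightarrow> 'a fps fps" where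
  "fps_snd f = Abs_fps (\<lambda>n. fps_const (fps_nth f n))"

lemma fps_snd_nth [simp]: "fps_nth (fps_snd f) n = fps_const (fps_nth f n)"
  by (simp add: fps_snd_def)

lemma fps_const_sum: "fps_const (sum f A) = (\<Sum>a\<in>A. fps_const (f a))"
  by (induction A rule: infinite_finite_induct) (simp_all flip: fps_const_add)

lemma fps_snd_mult: "fps_snd (f * g) = fps_snd f * fps_snd g"
  by (rule fps_ext) (simp add: fps_mult_nth fps_const_sum)

lemma fps_snd_add: "fps_snd (f + g) = fps_snd f + fps_snd g"
  by (rule fps_ext) simp

lemma fps_snd_diff: "fps_snd (f - g) = fps_snd f - fps_snd g"
  by (rule fps_ext) simp

lemma fps_snd_1: "fps_snd 1 = 1"
  by (rule fps_ext) simp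

lemma fps_snd_const: "fps_snd (fps_const c) = fps_const (fps_const c)"
  by (rule fps_ext) simp

lemma fps_snd_X: "fps_snd fps_X = fps_X"
  by (rule fps_ext) (simp add: fps_X_def)

lemma fps_snd_sum: "fps_snd (sum f A) = (\<Sum>a\<in>A. fps_snd (f a))"
  by (induction A rule: infinite_finite_induct) (simp_all add: fps_snd_add, (rule fps_ext, simp)+)

lemma fps_snd_coeff: "fps_nth (fps_nth (fps_const f * fps_snd g) \<beta>) \<alpha> = fps_nth f \<alpha> * fps_nth g \<beta>"
  by simp

lemma fps_const_const_mult_coeff:
  "fps_nth (fps_nth (fps_const (fps_const (c::'a::comm_ring_1)) * A) \<beta>) \<alpha> = c * fps_nth (fps_nth A \<beta>) \<alpha>"
  by simp

text \<open>The difference quotient (f(v) - f(u)) / (v - u): each monomial t^(n+1) of f contributes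
  all u^\<alpha> v^\<beta> with \<alpha> + \<beta> = n. It replaces division by v - u, which is not
  a unit.\<close>

definition fps_diffquot :: "'a::comm_ring_1 fps \<Rightarrow> 'a fps fps" where
  "fps_diffquot f = Abs_fps (\<lambda>\<beta>. Abs_fps (\<lambda>\<alpha>. fps_nth f (\<alpha> + \<beta> + 1)))"

lemma fps_diffquot: "(fps_X - fps_const fps_X) * fps_diffquot f = fps_snd f - fps_const f"
proof (rule fps_ext, rule fps_ext)
  fix \<beta> \<alpha>
  show "fps_nth (fps_nth ((fps_X - fps_const fps_X) * fps_diffquot f) \<beta>) \<alpha> =
        fps_nth (fps_nth (fps_snd f - fps_const f) \<beta>) \<alpha>"
    \<comment> \<open>Multiplication by v and by u both produce the coefficient of index \<alpha> +
      \<beta>; they cancel unless exactly one of the indices is 0.\<close>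
    by (cases \<alpha>; cases \<beta>) (auto simp: left_diff_distrib fps_diffquot_def)
qed

lemma fps_X_power_dvd_coeff: "\<lbrakk>f = fps_X ^ k * g; \<alpha> < k\<rbrakk> \<Longrightarrow> fps_nth f \<alpha> = 0"
  by (simp add: fps_X_power_mult_nth)

text \<open>For \<open>c \<noteq> 0\<close> the series \<open>c + v - u\<close> is a unit, so it can be cancelled modulo \<open>(u^k, v^l)\<close>.\<close>

lemma fps_fps_unit_cancel:
  fixes A :: "'a::field fps fps"
  assumes c: "c \<noteq> 0"
    and van: "\<And>\<alpha> \<beta>. \<alpha> < k \<Longrightarrow> \<beta> < l \<Longrightarrow>
      fps_nth (fps_nth ((fps_const (fps_const c) + (fps_X - fps_const fps_X)) * A) \<beta>) \<alpha> = 0"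
  shows "\<alpha> < k \<Longrightarrow> \<beta> < l \<Longrightarrow> fps_nth (fps_nth A \<beta>) \<alpha> = 0"
proof (induction "\<alpha> + \<beta>" arbitrary: \<alpha> \<beta> rule: less_induct)
  case less
  \<comment> \<open>Apart from c times the wanted coefficient, only coefficients of total degree one
    lower occur, hence the induction on \<alpha> + \<beta>.\<close>
  have "fps_nth (fps_nth ((fps_const (fps_const c) + (fps_X - fps_const fps_X)) * A) \<beta>) \<alpha> =
     c * fps_nth (fps_nth A \<beta>) \<alpha> + (if \<beta> = 0 then 0 else fps_nth (fps_nth A (\<beta> - 1)) \<alpha>)
       - (if \<alpha> = 0 then 0 else fps_nth (fps_nth A \<beta>) (\<alpha> - 1))"
    by (auto simp: left_diff_distrib distrib_right)
  moreover have "(if \<beta> = 0 then 0 else fps_nth (fps_nth A (\<beta> - 1)) \<alpha>) = 0"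
    using less.hyps[of \<alpha> "\<beta> - 1"] less.prems by auto
  moreover have "(if \<alpha> = 0 then 0 else fps_nth (fps_nth A \<beta>) (\<alpha> - 1)) = 0"
    using less.hyps[of "\<alpha> - 1" \<beta>] less.prems by auto
  ultimately show ?case
    using van[OF less.prems] c by simp
qed

section \<open>Partial fractions\<close>

text \<open>At a root only the summand omitting that root survives; away from the roots the formula
  is the logarithmic derivative. The derivative of the interpolation formula at a node needs both
  cases.\<close>

lemma poly_pderiv_root_prod:
  fixes z :: "'n::finite \<Rightarrow> 'a::field"
  assumes inj: "inj z"
  shows "poly (pderiv (\<Prod>j\<in>S. [:- z j, 1:])) (z a) =
    (if a \<in> S then (\<Prod>j\<in>S - {a}. z a - z j)
     else (\<Prod>j\<in>S. z a - z j) * (\<Sum>j\<in>S. 1 / (z a - z j)))"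
proof -
  have eq: "poly (pderiv (\<Prod>j\<in>S. [:- z j, 1:])) (z a) = (\<Sum>b\<in>S. \<Prod>j\<in>S - {b}. z a - z j)"
    by (simp add: pderiv_prod poly_sum poly_prod pderiv_pCons)
  show ?thesis
  proof (cases "a \<in> S")
    case True
    have "(\<Sum>b\<in>S. \<Prod>j\<in>S - {b}. z a - z j) = (\<Sum>b\<in>S. if b = a then (\<Prod>j\<in>S - {a}. z a - z j) else 0)"
      using True by (intro sum.cong) (auto intro!: prod_zero bexI[of _ a])
    with True show ?thesis unfolding eq by simp
  next
    case False
    have "(\<Prod>j\<in>S - {b}. z a - z j) = (\<Prod>j\<in>S. z a - z j) * (1 / (z a - z b))" if "b \<in> S" for b
    proof -
      have "z a - z b \<noteq> 0" using that False inj by (auto simp: inj_def)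
      then show ?thesis
        using that by (simp add: prod.remove[of S b])
    qed
    with False show ?thesis unfolding eq by (simp add: sum_distrib_left)
  qed
qed

lemma pderiv_sum: "pderiv (sum f A) = (\<Sum>a\<in>A. pderiv (f a))"
  by (induction A rule: infinite_finite_induct) (simp_all add: pderiv_add)

lemma fps_nth_prod_0: "fps_nth (prod f A) 0 = (\<Prod>a\<in>A. fps_nth (f a) 0)"
  by (induction A rule: infinite_finite_induct) simp_all

text \<open>The data at one point x: \<open>z\<close> will be its coordinates, \<open>w\<close> the
  diagonal contravariant metric components, and \<open>e\<close> the leading coefficient -4K.
  \<open>d\<close> stays an unspecified parameter.\<close>

locale interpolation =
  fixes z :: "'n::finite \<Rightarrow> 'a::field" and p :: "'a poly" and d e :: 'a and w :: "'n \<Rightarrow> 'a"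
  assumes inj: "inj z"
    and w_eq: "w a = poly p (z a) / (\<Prod>j\<in>UNIV - {a}. z a - z j)"
    and p_eq: "p = [:d, e:] * (\<Prod>a\<in>UNIV. [:- z a, 1:]) +
      (\<Sum>a\<in>UNIV. smult (w a) (\<Prod>j\<in>UNIV - {a}. [:- z j, 1:]))"
begin

text \<open>The expansion of p/D at \<mu>, given by its partial fractions rather than by division,
  so that expansions at two different points can be subtracted term by term.\<close>

definition quot :: "'a \<Rightarrow> 'a fps" where
  "quot \<mu> = fps_const d + fps_const e * shifted_X \<mu> 0 + (\<Sum>a\<in>UNIV. fps_const (w a) * recip_X \<mu> (z a))"

lemma prod_recip:
  assumes "\<mu> \<noteq> z a"
  shows "(\<Prod>j\<in>UNIV. shifted_X \<mu> (z j)) * recip_X \<mu> (z a) = (\<Prod>j\<in>UNIV - {a}. shifted_X \<mu> (z j))"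
proof -
  have "(\<Prod>j\<in>UNIV. shifted_X \<mu> (z j)) * recip_X \<mu> (z a) =
      (recip_X \<mu> (z a) * shifted_X \<mu> (z a)) * (\<Prod>j\<in>UNIV - {a}. shifted_X \<mu> (z j))"
    by (subst prod.remove[of UNIV a]) (simp_all add: algebra_simps)
  then show ?thesis by (simp add: recip_X_mult[OF assms])
qed

lemma prod_quot:
  assumes "\<And>a. \<mu> \<noteq> z a"
  shows "(\<Prod>a\<in>UNIV. shifted_X \<mu> (z a)) * quot \<mu> = taylor_poly \<mu> p"
proof -
  have "taylor_poly \<mu> p = (fps_const d + fps_const e * shifted_X \<mu> 0) * (\<Prod>a\<in>UNIV. shifted_X \<mu> (z a))
     + (\<Sum>a\<in>UNIV. fps_const (w a) * (\<Prod>j\<in>UNIV - {a}. shifted_X \<mu> (z j)))"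
    by (subst p_eq)
       (simp only: taylor_poly_add taylor_poly_mult taylor_poly_sum taylor_poly_smult taylor_poly_prod
          taylor_poly_linear taylor_poly_linear'[of _ d e])
  also have "\<dots> = (\<Prod>a\<in>UNIV. shifted_X \<mu> (z a)) * quot \<mu>"
    unfolding quot_def prod_recip[OF assms, symmetric]
    by (simp add: distrib_left sum_distrib_left algebra_simps)
  finally show ?thesis ..
qed

text \<open>With t = \<mu> + u and s = \<nu> + v, each pole satisfies 1/(t - z) - 1/(s - z) = (s -
  t) / ((t - z)(s - z)), the linear part gives -(s - t) e, and d cancels. After multiplication by
  y(t) y(s) the bracket generates the Gram matrix.\<close>

lemma bivariate_identity:
  assumes "\<And>a. \<mu> \<noteq> z a" "\<And>a. \<nu> \<noteq> z a"
  shows "(fps_const (fps_const (\<nu> - \<mu>)) + (fps_X - fps_const fps_X)) *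
     ((\<Sum>a\<in>UNIV. fps_const (fps_const (w a)) * (fps_const (recip_X \<mu> (z a)) * fps_snd (recip_X \<nu> (z a))))
       - fps_const (fps_const e))
     = fps_const (quot \<mu>) - fps_snd (quot \<nu>)"
proof -
  define T1 T2 :: "'a fps fps" where "T1 = fps_const (shifted_X \<mu> 0)" and "T2 = fps_snd (shifted_X \<nu> 0)"
  define E1 E2 where "E1 a = fps_const (recip_X \<mu> (z a))" and "E2 a = fps_snd (recip_X \<nu> (z a))" for a
  define W where "W a = fps_const (fps_const (w a))" for a
  have T: "fps_const (fps_const (\<nu> - \<mu>)) + (fps_X - fps_const fps_X) = T2 - T1"
    by (simp add: T1_def T2_def shifted_X_def fps_snd_add fps_snd_const fps_snd_X
          algebra_simps flip: fps_const_add fps_const_sub)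
  have 1: "E1 a * (T1 - fps_const (fps_const (z a))) = 1" for a
  proof -
    have "T1 - fps_const (fps_const (z a)) = fps_const (shifted_X \<mu> (z a))"
      by (simp add: T1_def shifted_X_def algebra_simps flip: fps_const_add fps_const_sub)
    then show ?thesis
      using recip_X_mult[OF assms(1), of a] by (simp add: E1_def)
  qed
  have 2: "E2 a * (T2 - fps_const (fps_const (z a))) = 1" for a
  proof -
    have "T2 - fps_const (fps_const (z a)) = fps_snd (shifted_X \<nu> (z a))"
      by (simp add: T2_def shifted_X_def fps_snd_add fps_snd_diff fps_snd_const fps_snd_X algebra_simps flip: fps_const_add fps_const_sub)
    then show ?thesis
      using recip_X_mult[OF assms(2), of a] by (simp add: E2_def fps_snd_1 flip: fps_snd_mult)
  qed
  have 3: "(T2 - T1) * (W a * (E1 a * E2 a)) = W a * E1 a - W a * E2 a" for a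
  proof -
    have "(T2 - T1) * (W a * (E1 a * E2 a)) =
      W a * (E1 a * (E2 a * (T2 - fps_const (fps_const (z a)))) - E2 a * (E1 a * (T1 - fps_const (fps_const (z a)))))"
      by (simp add: algebra_simps)
    then show ?thesis by (simp only: 1 2) (simp add: algebra_simps)
  qed
  have q1: "fps_const (quot \<mu>) = fps_const (fps_const d) + fps_const (fps_const e) * T1 + (\<Sum>a\<in>UNIV. W a * E1 a)"
    by (simp add: quot_def T1_def W_def E1_def fps_const_sum flip: fps_const_add fps_const_mult)
  have q2: "fps_snd (quot \<nu>) = fps_const (fps_const d) + fps_const (fps_const e) * T2 + (\<Sum>a\<in>UNIV. W a * E2 a)"
    by (simp add: quot_def T2_def W_def E2_def fps_snd_add fps_snd_mult fps_snd_const fps_snd_sum)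
  have "(T2 - T1) * ((\<Sum>a\<in>UNIV. W a * (E1 a * E2 a)) - fps_const (fps_const e))
     = (\<Sum>a\<in>UNIV. (T2 - T1) * (W a * (E1 a * E2 a))) - (T2 - T1) * fps_const (fps_const e)"
    by (simp add: right_diff_distrib sum_distrib_left)
  also have "\<dots> = fps_const (quot \<mu>) - fps_snd (quot \<nu>)"
    unfolding 3 q1 q2 by (simp add: sum_subtractf algebra_simps)
  finally show ?thesis unfolding T by (simp add: W_def E1_def E2_def)
qed

text \<open>For e = -4K and differentials -(y E)/2, the left-hand side is 4 (g^*(dY, dY') + K Y Y'),
  the quantity to be computed.\<close>

lemma gram_coeff:
  "(\<Sum>a\<in>UNIV. w a * fps_nth (y1 * recip_X \<mu> (z a)) \<alpha> * fps_nth (y2 * recip_X \<nu> (z a)) \<beta>)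
     - e * (fps_nth y1 \<alpha> * fps_nth y2 \<beta>) =
   fps_nth (fps_nth (fps_const y1 * fps_snd y2 *
     ((\<Sum>a\<in>UNIV. fps_const (fps_const (w a)) * (fps_const (recip_X \<mu> (z a)) * fps_snd (recip_X \<nu> (z a))))
       - fps_const (fps_const e))) \<beta>) \<alpha>" (is "_ = fps_nth (fps_nth (_ * _ * (?S - _)) \<beta>) \<alpha>")
proof -
  have "fps_const y1 * fps_snd y2 * (?S - fps_const (fps_const e)) =
    (\<Sum>a\<in>UNIV. fps_const (fps_const (w a)) * (fps_const (y1 * recip_X \<mu> (z a)) * fps_snd (y2 * recip_X \<nu> (z a))))
      - fps_const (fps_const e) * (fps_const y1 * fps_snd y2)"
    by (simp add: right_diff_distrib sum_distrib_left fps_snd_mult mult_ac flip: fps_const_mult)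
  then show ?thesis
    by (simp only: fps_sum_nth fps_snd_coeff fps_const_const_mult_coeff fps_sub_nth mult.assoc)
qed

lemma root_mult_quot:
  assumes "\<And>a. \<mu> \<noteq> z a" "y * y = (\<Prod>a\<in>UNIV. shifted_X \<mu> (z a))"
    "taylor_poly \<mu> p = fps_X ^ k * t"
  shows "y * quot \<mu> = fps_X ^ k * (t * inverse y)"
proof -
  have "fps_nth (\<Prod>a\<in>UNIV. shifted_X \<mu> (z a)) 0 \<noteq> 0"
    using assms(1) by (simp add: fps_nth_prod_0 shifted_X_def)
  then have y0: "fps_nth y 0 \<noteq> 0"
    using assms(2) by (metis fps_mult_nth_0 mult_zero_left)
  have "y * (y * quot \<mu>) = fps_X ^ k * t"
    by (metis mult.assoc prod_quot[OF assms(1)] assms(2,3))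
  then have "(inverse y * y) * (y * quot \<mu>) = inverse y * (fps_X ^ k * t)"
    by (simp add: mult.assoc)
  then show ?thesis by (simp only: inverse_mult_eq_1[OF y0] mult_1_left) (simp only: mult_ac)
qed

text \<open>Multiplying the two-point identity by y(t) y(s) gives (p/y)(t) y(s) - y(t) (p/y)(s). The
  first term vanishes to order k in u, the second to order l in v, and s - t is a unit because its
  constant term is \<nu> - \<mu>.\<close>

lemma gram_distinct:
  assumes \<mu>: "\<And>a. \<mu> \<noteq> z a" and \<nu>: "\<And>a. \<nu> \<noteq> z a"
    and y1: "y1 * y1 = (\<Prod>a\<in>UNIV. shifted_X \<mu> (z a))"
    and y2: "y2 * y2 = (\<Prod>a\<in>UNIV. shifted_X \<nu> (z a))"
    and t1: "taylor_poly \<mu> p = fps_X ^ k * t1" and t2: "taylor_poly \<nu> p = fps_X ^ l * t2"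
    and "\<mu> \<noteq> \<nu>" and "\<alpha> < k" "\<beta> < l"
  shows "(\<Sum>a\<in>UNIV. w a * fps_nth (y1 * recip_X \<mu> (z a)) \<alpha> * fps_nth (y2 * recip_X \<nu> (z a)) \<beta>) =
     e * (fps_nth y1 \<alpha> * fps_nth y2 \<beta>)"
proof -
  let ?V = "fps_const (fps_const (\<nu> - \<mu>)) + (fps_X - fps_const fps_X)"
  let ?Z = "fps_const y1 * fps_snd y2 *
     ((\<Sum>a\<in>UNIV. fps_const (fps_const (w a)) * (fps_const (recip_X \<mu> (z a)) * fps_snd (recip_X \<nu> (z a))))
       - fps_const (fps_const e))"
  have "?V * ?Z = fps_const y1 * fps_snd y2 * (fps_const (quot \<mu>) - fps_snd (quot \<nu>))"
    using bivariate_identity[OF \<mu> \<nu>] by (simp add: mult_ac)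
  also have "\<dots> = fps_const (y1 * quot \<mu>) * fps_snd y2 - fps_const y1 * fps_snd (y2 * quot \<nu>)"
    by (simp add: fps_snd_mult algebra_simps flip: fps_const_mult)
  finally have V: "?V * ?Z = fps_const (y1 * quot \<mu>) * fps_snd y2 - fps_const y1 * fps_snd (y2 * quot \<nu>)" .
  have "fps_nth (fps_nth ?Z \<beta>) \<alpha> = 0"
  proof (rule fps_fps_unit_cancel[where c = "\<nu> - \<mu>" and k = k and l = l])
    fix \<alpha> \<beta> assume "\<alpha> < k" "\<beta> < l"
    then have "fps_nth (y1 * quot \<mu>) \<alpha> = 0" "fps_nth (y2 * quot \<nu>) \<beta> = 0"
      using root_mult_quot[OF \<mu> y1 t1] root_mult_quot[OF \<nu> y2 t2] fps_X_power_dvd_coeff by blast+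
    then show "fps_nth (fps_nth (?V * ?Z) \<beta>) \<alpha> = 0"
      unfolding V by (simp add: fps_snd_coeff del: fps_const_mult)
  qed (use assms in auto)
  then show ?thesis
    using gram_coeff[of y1 \<mu> \<alpha> y2 \<nu> \<beta>] by simp
qed

text \<open>Substituting y(v) = y(u) + (v - u) h splits y(u) y(v) (q(u) - q(v)) into p(u) - p(v)
  plus multiples of y q. Every part is divisible by v - u, and the parts with y q vanish to order k
  in one variable, so only the difference quotient of p remains.\<close>

lemma gram_same:
  assumes \<mu>: "\<And>a. \<mu> \<noteq> z a"
    and y: "y * y = (\<Prod>a\<in>UNIV. shifted_X \<mu> (z a))"
    and t: "taylor_poly \<mu> p = fps_X ^ k * t"
    and \<alpha>: "\<alpha> < k" and \<beta>: "\<beta> < k"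
  shows "(\<Sum>a\<in>UNIV. w a * fps_nth (y * recip_X \<mu> (z a)) \<alpha> * fps_nth (y * recip_X \<mu> (z a)) \<beta>) =
     e * (fps_nth y \<alpha> * fps_nth y \<beta>) - fps_nth (taylor_poly \<mu> p) (\<alpha> + \<beta> + 1)"
proof -
  let ?V = "fps_X - fps_const fps_X :: 'a fps fps"
  let ?q = "quot \<mu>"
  let ?Z = "fps_const y * fps_snd y *
     ((\<Sum>a\<in>UNIV. fps_const (fps_const (w a)) * (fps_const (recip_X \<mu> (z a)) * fps_snd (recip_X \<mu> (z a))))
       - fps_const (fps_const e))"
  define h where "h = fps_diffquot y"
  define R where "R = fps_const (y * ?q) * h + fps_snd (y * ?q) * h - fps_diffquot (taylor_poly \<mu> p)"
  have h: "fps_snd y = fps_const y + ?V * h"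
    by (simp add: h_def fps_diffquot)
  have p: "fps_snd y * (fps_snd y * fps_snd ?q) = fps_const y * (fps_const y * fps_const ?q) + ?V * fps_diffquot (taylor_poly \<mu> p)"
  proof -
    have "fps_snd (taylor_poly \<mu> p) = fps_const (taylor_poly \<mu> p) + ?V * fps_diffquot (taylor_poly \<mu> p)"
      by (simp add: fps_diffquot)
    moreover have "taylor_poly \<mu> p = y * (y * ?q)"
      using prod_quot[OF \<mu>] y by (metis mult.assoc)
    ultimately show ?thesis
      by (simp only: fps_snd_mult fps_const_mult[symmetric])
  qed
  have "?V * ?Z = fps_const y * fps_snd y * (fps_const ?q - fps_snd ?q)"
    using bivariate_identity[OF \<mu> \<mu>] by (simp add: mult_ac)
  also have "\<dots> = fps_const y * fps_const ?q * (fps_const y + ?V * h)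
      - fps_snd y * fps_snd ?q * (fps_snd y - ?V * h)"
    unfolding h[symmetric] by (simp add: h algebra_simps del: fps_const_mult)
  also have "\<dots> = ?V * R"
    using p by (simp add: R_def fps_snd_mult algebra_simps flip: fps_const_mult)
  finally have "?V * ?Z = ?V * R" .
  \<comment> \<open>Not a unit, but nonzero in an integral domain, which is enough to cancel
    it.\<close>
  moreover have "?V \<noteq> 0"
  proof
    assume "?V = 0"
    then have "fps_nth ?V 1 = 0" by simp
    then show False by simp
  qed
  ultimately have "?Z = R"
    using mult_left_cancel by blast
  moreover have "fps_nth (fps_nth R \<beta>) \<alpha> = - fps_nth (taylor_poly \<mu> p) (\<alpha> + \<beta> + 1)"
  proof -
    have 1: "y * ?q = fps_X ^ k * (t * inverse y)"
      by (rule root_mult_quot[OF \<mu> y t])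
    have "fps_nth (fps_nth (fps_const (y * ?q) * h) \<beta>) \<alpha> = 0"
      using \<alpha> by (simp add: 1 fps_X_power_mult_nth mult.assoc)
    moreover have "fps_snd (y * ?q) = fps_X ^ k * fps_snd (t * inverse y)"
    proof -
      have "fps_snd (fps_X ^ k :: 'a fps) = fps_X ^ k"
        by (induction k) (simp_all add: fps_snd_1 fps_snd_mult fps_snd_X)
      then show ?thesis by (simp add: 1 fps_snd_mult)
    qed
    then have "fps_nth (fps_snd (y * ?q) * h) \<beta> = 0"
      using \<beta> by (simp add: fps_X_power_mult_nth mult.assoc)
    ultimately show ?thesis
      by (simp add: R_def fps_diffquot_def)
  qed
  ultimately show ?thesis
    using gram_coeff[of y \<mu> \<alpha> y \<mu> \<beta>] by (simp add: algebra_simps)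
qed

text \<open>The interpolation formula is differentiated at z_a, where D vanishes and D' is the
  product of differences. This eliminates d in favour of p'(z_a), the quantity that occurs in the
  Christoffel symbols.\<close>

lemma pderiv_at_node:
  "poly (pderiv p) (z a) / (\<Prod>j\<in>UNIV - {a}. z a - z j) =
    d + e * z a + w a * (\<Sum>j\<in>UNIV - {a}. 1 / (z a - z j)) + (\<Sum>c\<in>UNIV - {a}. w c / (z a - z c))"
proof -
  let ?\<Delta> = "\<Prod>j\<in>UNIV - {a}. z a - z j"
  have \<Delta>: "?\<Delta> \<noteq> 0"
    using inj by (auto simp: inj_def)
  have D0: "(\<Prod>j\<in>UNIV. z a - z j) = 0"
    by (rule prod_zero) auto
  have c: "(\<Prod>j\<in>UNIV - {c} - {a}. z a - z j) = ?\<Delta> / (z a - z c)" if "c \<noteq> a" for c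
  proof -
    have "z a - z c \<noteq> 0" using inj that by (auto simp: inj_def)
    moreover have "UNIV - {c} - {a} = UNIV - {a} - {c}" by auto
    ultimately show ?thesis
      using that by (simp add: prod.remove[of "UNIV - {a}" c])
  qed
  have "poly (pderiv p) (z a) = (d + e * z a) * ?\<Delta> +
      (\<Sum>c\<in>UNIV. w c * poly (pderiv (\<Prod>j\<in>UNIV - {c}. [:- z j, 1:])) (z a))"
    by (subst p_eq)
       (simp add: pderiv_add pderiv_mult pderiv_sum pderiv_smult poly_sum poly_prod poly_pderiv_root_prod[OF inj] D0 pderiv_pCons algebra_simps
         del: mult_pCons_left)
  also have "(\<Sum>c\<in>UNIV. w c * poly (pderiv (\<Prod>j\<in>UNIV - {c}. [:- z j, 1:])) (z a)) =
     w a * (?\<Delta> * (\<Sum>j\<in>UNIV - {a}. 1 / (z a - z j))) + (\<Sum>c\<in>UNIV - {a}. w c * (?\<Delta> / (z a - z c)))"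
    by (subst sum.remove[of UNIV a]) (auto simp: poly_pderiv_root_prod[OF inj] c intro!: sum.cong)
  also have "(\<Sum>c\<in>UNIV - {a}. w c * (?\<Delta> / (z a - z c))) = ?\<Delta> * (\<Sum>c\<in>UNIV - {a}. w c / (z a - z c))"
    by (simp add: sum_distrib_left mult_ac)
  finally show ?thesis using \<Delta> by (simp add: divide_simps) (simp add: algebra_simps)
qed

text \<open>Partial fractions of p / (D (t - z_a)): a double pole from the summand a, simple poles
  from all others, and the constant e from t/(t - z_a) = 1 + z_a/(t - z_a). The coefficient at
  \<open>recip_X \<mu> (z a)\<close> is written so that it can be recognised as -w_a times the
  derivative of log g_aa along x^a.\<close>

lemma quot_recip:
  assumes \<mu>: "\<And>a. \<mu> \<noteq> z a"
  shows "quot \<mu> * recip_X \<mu> (z a) = fps_const e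
     + fps_const (poly (pderiv p) (z a) / (\<Prod>j\<in>UNIV - {a}. z a - z j) - w a * (\<Sum>j\<in>UNIV - {a}. 1 / (z a - z j))) * recip_X \<mu> (z a)
     + fps_const (w a) * recip_X \<mu> (z a) ^ 2
     - (\<Sum>c\<in>UNIV - {a}. fps_const (w c / (z a - z c)) * recip_X \<mu> (z c))"
proof -
  define E where "E c = recip_X \<mu> (z c)" for c
  have T: "shifted_X \<mu> 0 * E a = 1 + fps_const (z a) * E a"
  proof -
    have "shifted_X \<mu> 0 = shifted_X \<mu> (z a) + fps_const (z a)"
      by (simp add: shifted_X_def)
    then show ?thesis
      using recip_X_mult[OF \<mu>, of a] by (simp add: E_def algebra_simps)
  qed
  have EE: "fps_const (w c) * (E c * E a) = fps_const (w c / (z a - z c)) * E a - fps_const (w c / (z a - z c)) * E c"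
    if "c \<in> UNIV - {a}" for c
  proof -
    have "z c \<noteq> z a" using that inj by (auto simp: inj_def)
    then have "fps_const (w c) * (E c * E a) = fps_const (w c * inverse (z c - z a)) * (E c - E a)"
      unfolding E_def by (subst recip_X_partial_fraction[OF \<mu> \<mu>]) (simp_all flip: mult.assoc)
    also have "w c * inverse (z c - z a) = - (w c / (z a - z c))"
      by (metis minus_diff_eq inverse_minus_eq mult_minus_right divide_inverse)
    finally show ?thesis by (simp add: algebra_simps flip: fps_const_neg)
  qed
  have "(\<Sum>c\<in>UNIV. fps_const (w c) * E c) * E a = fps_const (w a) * E a ^ 2 + (\<Sum>c\<in>UNIV - {a}. fps_const (w c) * (E c * E a))"
    by (subst sum.remove[of UNIV a]) (simp_all add: distrib_right sum_distrib_right power2_eq_square mult.assoc)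
  also have "\<dots> = fps_const (w a) * E a ^ 2 + fps_const (\<Sum>c\<in>UNIV - {a}. w c / (z a - z c)) * E a
       - (\<Sum>c\<in>UNIV - {a}. fps_const (w c / (z a - z c)) * E c)"
    by (simp add: EE sum_subtractf fps_const_sum sum_distrib_right)
  finally have S: "(\<Sum>c\<in>UNIV. fps_const (w c) * E c) * E a = \<dots>" .
  have "quot \<mu> * E a = fps_const d * E a + fps_const e * (shifted_X \<mu> 0 * E a) + (\<Sum>c\<in>UNIV. fps_const (w c) * E c) * E a"
    by (simp add: quot_def E_def algebra_simps)
  also have "\<dots> = fps_const e + fps_const (d + e * z a + (\<Sum>c\<in>UNIV - {a}. w c / (z a - z c))) * E a
     + fps_const (w a) * E a ^ 2 - (\<Sum>c\<in>UNIV - {a}. fps_const (w c / (z a - z c)) * E c)"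
    unfolding T S by (simp add: algebra_simps flip: fps_const_add fps_const_mult)
  also have "d + e * z a + (\<Sum>c\<in>UNIV - {a}. w c / (z a - z c)) =
     poly (pderiv p) (z a) / (\<Prod>j\<in>UNIV - {a}. z a - z j) - w a * (\<Sum>j\<in>UNIV - {a}. 1 / (z a - z j))"
    by (simp add: pderiv_at_node)
  finally show ?thesis by (simp add: E_def)
qed

end

section \<open>Coefficientwise partial derivatives\<close>

text \<open>\<open>pd\<close> is total and says nothing about existence; this relational form
  carries existence together with the value.\<close>

definition has_pd :: "(real^'n::finite \<Rightarrow> complex) \<Rightarrow> 'n \<Rightarrow> real^'n \<Rightarrow> complex \<Rightarrow> bool" where
  "has_pd f i x D \<longleftrightarrow> ((\<lambda>t::real. f (x + t *\<^sub>R axis i 1)) has_vector_derivative D) (at 0)"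

lemma pd_eqI: "has_pd f i x D \<Longrightarrow> pd i f x = D"
  unfolding has_pd_def pd_def by (rule vector_derivative_at)

lemma has_pd_unique: "has_pd f i x D \<Longrightarrow> has_pd f i x D' \<Longrightarrow> D = D'"
  using pd_eqI by metis

lemma has_pd_pd: "\<exists>D. has_pd f i x D \<Longrightarrow> has_pd f i x (pd i f x)"
  using pd_eqI by metis

lemma has_pd_const [simp]: "has_pd (\<lambda>x. c) i x 0"
  by (simp add: has_pd_def)

lemma has_pd_add: "has_pd f i x D \<Longrightarrow> has_pd g i x E \<Longrightarrow> has_pd (\<lambda>x. f x + g x) i x (D + E)"
  unfolding has_pd_def by (rule has_vector_derivative_add)

lemma has_pd_diff: "has_pd f i x D \<Longrightarrow> has_pd g i x E \<Longrightarrow> has_pd (\<lambda>x. f x - g x) i x (D - E)"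
  unfolding has_pd_def by (rule has_vector_derivative_diff)

lemma has_pd_mult:
  "has_pd f i x D \<Longrightarrow> has_pd g i x E \<Longrightarrow> has_pd (\<lambda>x. f x * g x) i x (f x * E + D * g x)"
  using has_vector_derivative_mult[of "\<lambda>t. f (x + t *\<^sub>R axis i 1)" D 0 UNIV "\<lambda>t. g (x + t *\<^sub>R axis i 1)" E]
  unfolding has_pd_def by simp

lemma has_pd_cmult: "has_pd f i x D \<Longrightarrow> has_pd (\<lambda>x. c * f x) i x (c * D)"
  using has_pd_mult[OF has_pd_const[of c i x], of f D] by simp

lemma has_pd_sum:
  "(\<And>j. j \<in> S \<Longrightarrow> has_pd (f j) i x (D j)) \<Longrightarrow> has_pd (\<lambda>x. \<Sum>j\<in>S. f j x) i x (\<Sum>j\<in>S. D j)"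
  unfolding has_pd_def by (rule has_vector_derivative_sum)

lemma has_pd_chain:
  assumes "has_pd f i x D" "(g has_field_derivative g') (at (f x))"
  shows "has_pd (\<lambda>x. g (f x)) i x (g' * D)"
  using field_vector_diff_chain_at[of "\<lambda>t. f (x + t *\<^sub>R axis i 1)" D 0 g g'] assms
  by (simp add: has_pd_def o_def mult.commute)

lemma has_pd_coord: "has_pd (\<lambda>x. complex_of_real (x $ a)) i x (if a = i then 1 else 0)"
proof -
  have "((\<lambda>t::real. of_real (x $ a) + complex_of_real t * (if a = i then 1 else 0))
      has_vector_derivative (if a = i then 1 else 0)) (at 0)"
    by (auto intro!: derivative_eq_intros simp: has_vector_derivative_real_field)
  moreover have "(\<lambda>t::real. complex_of_real ((x + t *\<^sub>R axis i 1) $ a)) =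
     (\<lambda>t::real. of_real (x $ a) + complex_of_real t * (if a = i then 1 else 0))"
    by (auto simp: axis_def)
  ultimately show ?thesis by (simp only: has_pd_def)
qed

lemma has_pd_coord_diff:
  "has_pd (\<lambda>x. complex_of_real (x $ a) - of_real (x $ b)) i x (of_bool (a = i) - of_bool (b = i))"
  using has_pd_diff[OF has_pd_coord[of a i x] has_pd_coord[of b i x]] by (simp add: of_bool_def)

lemma has_pd_inverse:
  assumes "has_pd f i x D" "f x \<noteq> 0"
  shows "has_pd (\<lambda>x. inverse (f x)) i x (- (inverse (f x) * D * inverse (f x)))"
  using has_pd_chain[OF assms(1) DERIV_inverse[OF assms(2)]] by (simp add: power2_eq_square mult_ac)

lemma has_pd_divide:
  assumes "has_pd f i x D" "has_pd g i x E" "g x \<noteq> 0"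
  shows "has_pd (\<lambda>x. f x / g x) i x (f x * - (inverse (g x) * E * inverse (g x)) + D * inverse (g x))"
  unfolding divide_inverse using has_pd_mult[OF assms(1) has_pd_inverse[OF assms(2,3)]] .

lemma has_pd_poly: "has_pd f i x D \<Longrightarrow> has_pd (\<lambda>x. poly p (f x)) i x (poly (pderiv p) (f x) * D)"
  by (rule has_pd_chain[of f i x D "poly p"], assumption, rule poly_DERIV)

text \<open>Passing the derivative of each factor as the factor times D_j keeps the whole product
  intact in the result, so no sum over omitted factors appears.\<close>

lemma has_pd_prod_log:
  assumes "\<And>j. j \<in> S \<Longrightarrow> has_pd (f j) i x (f j x * D j)"
  shows "has_pd (\<lambda>x. \<Prod>j\<in>S. f j x) i x ((\<Prod>j\<in>S. f j x) * (\<Sum>j\<in>S. D j))"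
  using assms
proof (induction S rule: infinite_finite_induct)
  case (insert j S)
  then have "has_pd (\<lambda>x. f j x * (\<Prod>j\<in>S. f j x)) i x
     (f j x * ((\<Prod>j\<in>S. f j x) * (\<Sum>j\<in>S. D j)) + (f j x * D j) * (\<Prod>j\<in>S. f j x))"
    by (intro has_pd_mult) auto
  with insert.hyps show ?case by (simp add: algebra_simps)
qed auto

lemma eventually_line_in_open:
  fixes x v :: "'a::real_normed_vector"
  assumes "open U" "x \<in> U"
  shows "eventually (\<lambda>t::real. x + t *\<^sub>R v \<in> U) (at 0)"
proof -
  have "((\<lambda>t::real. x + t *\<^sub>R v) \<longlongrightarrow> x + 0 *\<^sub>R v) (at 0)"
    by (auto intro!: tendsto_eq_intros)
  then show ?thesis
    using assms topological_tendstoD by fastforce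
qed

lemma has_pd_transform:
  assumes "open U" "x \<in> U" "\<And>z. z \<in> U \<Longrightarrow> f z = g z" "has_pd f i x D"
  shows "has_pd g i x D"
proof -
  have "open ((\<lambda>t::real. x + t *\<^sub>R axis i 1) -` U)"
    by (intro open_vimage assms continuous_intros)
  then show ?thesis
    using assms unfolding has_pd_def
    by (elim has_vector_derivative_transform_within_open) auto
qed

lemma pd_cong:
  assumes "open U" "x \<in> U" "\<And>z. z \<in> U \<Longrightarrow> f z = g z"
  shows "pd i f x = pd i g x"
proof -
  have "eventually (\<lambda>t::real. x + t *\<^sub>R axis i 1 \<in> U) (at 0)"
    by (rule eventually_line_in_open[OF assms(1,2)])
  then have "eventually (\<lambda>t::real. f (x + t *\<^sub>R axis i 1) = g (x + t *\<^sub>R axis i 1)) (nhds 0)"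
    unfolding eventually_at_filter by eventually_elim (use assms(2,3) in auto)
  then show ?thesis
    unfolding pd_def by (intro vector_derivative_cong_eq) (auto elim: eventually_mono)
qed

lemma has_vector_derivative_0_iff:
  fixes H :: "real \<Rightarrow> 'a::real_normed_vector"
  shows "(H has_vector_derivative D) (at 0) \<longleftrightarrow> ((\<lambda>t. (H t - H 0) /\<^sub>R t) \<longlongrightarrow> D) (at 0)"
proof -
  have "(H has_vector_derivative D) (at 0) \<longleftrightarrow>
      ((\<lambda>t. norm (H t - H 0 - t *\<^sub>R D) / norm t) \<longlongrightarrow> 0) (at 0)"
    by (simp add: has_vector_derivative_def has_derivative_at bounded_linear_scaleR_left)
  also have "\<dots> \<longleftrightarrow> ((\<lambda>t. norm ((H t - H 0) /\<^sub>R t - D)) \<longlongrightarrow> 0) (at 0)"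
  proof (rule tendsto_cong)
    have "norm (H t - H 0 - t *\<^sub>R D) / norm t = norm ((H t - H 0) /\<^sub>R t - D)" if "t \<noteq> 0" for t
    proof -
      have "(H t - H 0) /\<^sub>R t - D = (H t - H 0 - t *\<^sub>R D) /\<^sub>R t"
        using that by (simp add: algebra_simps)
      then show ?thesis by (simp add: divide_inverse)
    qed
    then show "\<forall>\<^sub>F t in at 0. norm (H t - H 0 - t *\<^sub>R D) / norm t = norm ((H t - H 0) /\<^sub>R t - D)"
      by (simp add: eventually_at_filter)
  qed
  also have "\<dots> \<longleftrightarrow> ((\<lambda>t. (H t - H 0) /\<^sub>R t) \<longlongrightarrow> D) (at 0)"
    by (simp add: tendsto_norm_zero_iff flip: Lim_null)
  finally show ?thesis .
qed

text \<open>From (h(z) - h(x)) (h(z) + h(x)) = f(z) - f(x) and h(z) + h(x) \<rightarrow> 2 h(x)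
  \<noteq> 0, any continuous square root inherits partial derivatives, with no explicit
  branch.\<close>

lemma has_pd_sqrt:
  assumes U: "open U" "x \<in> U" and cont: "continuous_on U h"
    and sq: "\<And>z. z \<in> U \<Longrightarrow> h z * h z = f z"
    and f: "has_pd f i x D" and nz: "h x \<noteq> 0"
  shows "has_pd h i x (D / (2 * h x))"
proof -
  define H where "H t = h (x + t *\<^sub>R axis i 1)" for t :: real
  define A where "A t = f (x + t *\<^sub>R axis i 1)" for t :: real
  have H0: "H 0 = h x" and A0: "A 0 = f x" by (simp_all add: H_def A_def)
  have "isCont h (x + 0 *\<^sub>R axis i 1)"
    using cont U by (simp add: continuous_on_eq_continuous_at)
  then have "isCont H 0"
    unfolding H_def by (rule isCont_o2[rotated]) (intro continuous_intros)
  then have Hlim: "(H \<longlongrightarrow> h x) (at 0)" by (simp add: isCont_def H0)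
  have "((\<lambda>t. (A t - A 0) /\<^sub>R t) \<longlongrightarrow> D) (at 0)"
    using f unfolding has_pd_def A_def[symmetric] has_vector_derivative_0_iff .
  then have "((\<lambda>t. ((A t - A 0) /\<^sub>R t) / (H t + h x)) \<longlongrightarrow> D / (h x + h x)) (at 0)"
    by (intro tendsto_divide tendsto_add Hlim tendsto_const) (use nz in auto)
  moreover have "eventually (\<lambda>t. ((A t - A 0) /\<^sub>R t) / (H t + h x) = (H t - H 0) /\<^sub>R t) (at 0)"
  proof -
    have "((\<lambda>t. H t + h x) \<longlongrightarrow> h x + h x) (at 0)"
      by (intro tendsto_add Hlim tendsto_const)
    then have "eventually (\<lambda>t. H t + h x \<noteq> 0) (at 0)"
      by (rule tendsto_imp_eventually_ne) (use nz in auto)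
    moreover have "eventually (\<lambda>t::real. x + t *\<^sub>R axis i 1 \<in> U) (at 0)"
      by (rule eventually_line_in_open[OF U])
    ultimately show ?thesis
    proof eventually_elim
      case (elim t)
      have "A t - A 0 = (H t - H 0) * (H t + h x)"
        using sq[OF elim(2)] sq[OF U(2)] by (simp add: A_def H_def algebra_simps)
      with elim(1) show ?case by (simp add: scaleR_conv_of_real)
    qed
  qed
  ultimately have "((\<lambda>t. (H t - H 0) /\<^sub>R t) \<longlongrightarrow> D / (h x + h x)) (at 0)"
    by (rule Lim_transform_eventually)
  then show ?thesis
    unfolding has_pd_def H_def[symmetric] has_vector_derivative_0_iff by simp
qed

text \<open>Coefficientwise, so no topology on power series is involved; the product rule survives
  because each coefficient of a product is a finite sum.\<close>

definition has_fps_pd :: "(real^'n::finite \<Rightarrow> complex fps) \<Rightarrow> 'n \<Rightarrow> real^'n \<Rightarrow> complex fps \<Rightarrow> bool" where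
  "has_fps_pd f i x D \<longleftrightarrow> (\<forall>r. has_pd (\<lambda>x. fps_nth (f x) r) i x (fps_nth D r))"

lemma has_fps_pd_unique: "has_fps_pd f i x D \<Longrightarrow> has_fps_pd f i x D' \<Longrightarrow> D = D'"
  unfolding has_fps_pd_def by (blast intro: fps_ext has_pd_unique)

lemma has_fps_pd_const: "has_fps_pd (\<lambda>x. c) i x 0"
  by (simp add: has_fps_pd_def)

lemma has_fps_pd_add: "has_fps_pd f i x D \<Longrightarrow> has_fps_pd g i x E \<Longrightarrow> has_fps_pd (\<lambda>x. f x + g x) i x (D + E)"
  by (simp add: has_fps_pd_def has_pd_add)

lemma has_fps_pd_mult:
  assumes "has_fps_pd f i x D" "has_fps_pd g i x E"
  shows "has_fps_pd (\<lambda>x. f x * g x) i x (f x * E + D * g x)"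
  unfolding has_fps_pd_def
proof
  fix r
  have "has_pd (\<lambda>x. \<Sum>j=0..r. fps_nth (f x) j * fps_nth (g x) (r - j)) i x
    (\<Sum>j=0..r. fps_nth (f x) j * fps_nth E (r - j) + fps_nth D j * fps_nth (g x) (r - j))"
    using assms unfolding has_fps_pd_def by (intro has_pd_sum has_pd_mult) auto
  then show "has_pd (\<lambda>x. fps_nth (f x * g x) r) i x (fps_nth (f x * E + D * g x) r)"
    by (simp add: fps_mult_nth sum.distrib)
qed

lemma has_fps_pd_cmult: "has_fps_pd f i x D \<Longrightarrow> has_fps_pd (\<lambda>x. c * f x) i x (c * D)"
  using has_fps_pd_mult[OF has_fps_pd_const[of c i x], of f D] by simp

lemma has_fps_pd_transform:
  assumes "open U" "x \<in> U" "\<And>z. z \<in> U \<Longrightarrow> f z = g z" "has_fps_pd f i x D"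
  shows "has_fps_pd g i x D"
  unfolding has_fps_pd_def
proof
  fix r
  show "has_pd (\<lambda>x. fps_nth (g x) r) i x (fps_nth D r)"
    by (rule has_pd_transform[OF assms(1,2), of "\<lambda>x. fps_nth (f x) r"])
       (use assms in \<open>auto simp: has_fps_pd_def\<close>)
qed

lemma has_fps_pd_shifted_X: "has_fps_pd (\<lambda>x. shifted_X \<mu> (complex_of_real (x $ a))) i x (- fps_const (of_bool (a = i)))"
  unfolding has_fps_pd_def
proof
  fix r
  show "has_pd (\<lambda>x. fps_nth (shifted_X \<mu> (complex_of_real (x $ a))) r) i x (fps_nth (- fps_const (of_bool (a = i))) r)"
    using has_pd_diff[OF has_pd_const[of \<mu>] has_pd_coord[of a i x]]
    by (cases r) (auto simp: shifted_X_def fps_X_def)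
qed

text \<open>Existence comes from solving E T = 1 for one coefficient after the other; once it is
  known, differentiating E T = 1 yields the value.\<close>

lemma has_fps_pd_recip_X:
  fixes x :: "real^'n"
  assumes "complex_of_real (x $ a) \<noteq> \<mu>"
  shows "has_fps_pd (\<lambda>x. recip_X \<mu> (complex_of_real (x $ a))) i x
    (fps_const (of_bool (a = i)) * recip_X \<mu> (complex_of_real (x $ a)) ^ 2)"
proof -
  define U where "U = {x::real^'n. complex_of_real (x $ a) \<noteq> \<mu>}"
  have "open U"
    unfolding U_def by (intro open_Collect_neq continuous_intros)
  have x: "x \<in> U" using assms by (simp add: U_def)
  define E where "E x = recip_X \<mu> (complex_of_real (x $ a))" for x :: "real^'n"
  define T where "T x = shifted_X \<mu> (complex_of_real (x $ a))" for x :: "real^'n"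
  have ET: "E y * T y = 1" if "y \<in> U" for y
    using that recip_X_mult[of \<mu> "complex_of_real (y $ a)"] by (auto simp: U_def E_def T_def)
  have "\<exists>D. has_pd (\<lambda>x. fps_nth (E x) r) i x D" for r
  proof (induction r)
    case 0
    have "has_pd (\<lambda>x. inverse (\<mu> - complex_of_real (x $ a))) i x
       (- (inverse (\<mu> - complex_of_real (x $ a)) * (0 - (if a = i then 1 else 0)) * inverse (\<mu> - complex_of_real (x $ a))))"
      using assms by (intro has_pd_inverse has_pd_diff has_pd_const has_pd_coord) auto
    moreover have "fps_nth (E x) 0 = inverse (\<mu> - complex_of_real (x $ a))" for x
      by (simp add: E_def recip_X_def shifted_X_def)
    ultimately show ?case by auto
  next
    case (Suc r)
    then obtain D where D: "has_pd (\<lambda>x. fps_nth (E x) r) i x D" by blast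
    have 1: "has_pd (\<lambda>x. (- 1) * fps_nth (E x) r / (\<mu> - complex_of_real (x $ a))) i x
      ((- 1) * fps_nth (E x) r * - (inverse (\<mu> - complex_of_real (x $ a)) * (0 - (if a = i then 1 else 0)) * inverse (\<mu> - complex_of_real (x $ a)))
       + (- 1) * D * inverse (\<mu> - complex_of_real (x $ a)))"
      using assms by (intro has_pd_divide has_pd_cmult D has_pd_diff has_pd_const has_pd_coord) auto
    have 2: "(- 1) * fps_nth (E y) r / (\<mu> - complex_of_real (y $ a)) = fps_nth (E y) (Suc r)" if "y \<in> U" for y
    proof -
      have "fps_nth (E y * T y) (Suc r) = 0" by (simp add: ET[OF that])
      then have "fps_nth (E y) (Suc r) * (\<mu> - complex_of_real (y $ a)) + fps_nth (E y) r = 0"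
        by (simp add: T_def shifted_X_def distrib_left)
      then have "fps_nth (E y) r = - (fps_nth (E y) (Suc r) * (\<mu> - complex_of_real (y $ a)))"
        by (rule add_eq_0_iff[THEN iffD1])
      moreover have "\<mu> - complex_of_real (y $ a) \<noteq> 0"
        using that by (auto simp: U_def)
      ultimately show ?thesis by simp
    qed
    show ?case
      by (rule exI, rule has_pd_transform[OF \<open>open U\<close> x 2 1])
  qed
  then obtain D where "\<And>r. has_pd (\<lambda>x. fps_nth (E x) r) i x (D r)" by metis
  then have D: "has_fps_pd E i x (Abs_fps D)" by (simp add: has_fps_pd_def)
  define b :: "complex fps" where "b = fps_const (of_bool (a = i))"
  have "has_fps_pd (\<lambda>x. E x * T x) i x (E x * (- b) + Abs_fps D * T x)"
    unfolding T_def b_def by (intro has_fps_pd_mult D has_fps_pd_shifted_X)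
  moreover have "has_fps_pd (\<lambda>x. E x * T x) i x 0"
    by (rule has_fps_pd_transform[OF \<open>open U\<close> x _ has_fps_pd_const[of 1]]) (simp add: ET)
  ultimately have "E x * (- b) + Abs_fps D * T x = 0"
    using has_fps_pd_unique by blast
  then have "Abs_fps D * T x = E x * b"
    by simp
  then have "(E x * T x) * Abs_fps D = E x * (E x * b)"
    by (simp add: mult_ac)
  then have "Abs_fps D = b * E x ^ 2"
    using ET[OF x] by (simp add: power2_eq_square mult_ac)
  then show ?thesis using D unfolding b_def E_def[abs_def] by (simp only:)
qed

section \<open>Branches of the square root\<close>

lemma has_fps_expansion_taylor_poly:
  "(\<lambda>z. poly p (\<mu> + z)) has_fps_expansion taylor_poly \<mu> (p :: complex poly)"
proof (induction p)
  case (pCons c p)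
  have "(\<lambda>z. c + (\<mu> + z) * poly p (\<mu> + z)) has_fps_expansion
      fps_const c + (fps_const \<mu> + fps_X) * taylor_poly \<mu> p"
    by (intro fps_expansion_intros pCons.IH)
  also have "fps_const c + (fps_const \<mu> + fps_X) * taylor_poly \<mu> p = taylor_poly \<mu> (pCons c p)"
    by (simp add: taylor_poly_def pcompose_pCons fps_of_poly_add fps_of_poly_mult fps_of_poly_pCons
      fps_of_poly_const mult_ac del: mult_pCons_left mult_pCons_right)
  finally show ?case by simp
qed (simp add: taylor_poly_def)

lemma fps_expansion_poly: "fps_expansion (poly p) \<mu> = taylor_poly \<mu> p"
  by (rule fps_expansion_unique_complex[OF analytic_at_imp_has_fps_expansion has_fps_expansion_taylor_poly])
     (auto simp: analytic_at intro!: holomorphic_intros exI[of _ UNIV])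

lemma fps_half_unique: "f + f = g \<Longrightarrow> f = fps_const (1 / 2) * (g :: complex fps)"
proof (rule fps_ext)
  fix n assume "f + f = g"
  then have "fps_nth g n = fps_nth f n + fps_nth f n" by (metis fps_add_nth)
  then show "fps_nth f n = fps_nth (fps_const (1 / 2) * g) n" by simp
qed

text \<open>All rational constants are reduced to the one atom \<open>fps_const (1 / 2)\<close>, so
  that ring normalisation can match terms; \<open>fps_half_add\<close> then absorbs doubled
  ones.\<close>

lemma fps_half_simps:
  "fps_const (- 1 / 2 :: complex) = - fps_const (1 / 2)"
  "fps_const (1 / 4 :: complex) = fps_const (1 / 2) * fps_const (1 / 2)"
  "fps_const (- of_bool b / 2 :: complex) = - (of_bool b * fps_const (1 / 2))"
  "fps_const (of_bool b :: complex) = of_bool b"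
  by (auto simp: fps_eq_iff)

lemma fps_half_add: "fps_const (1 / 2 :: complex) * (f + f) = f"
  by (simp add: fps_eq_iff)

text \<open>The radius may depend on x, and the branch is tied together across points only by
  continuity at t = \<mu>, which excludes sign jumps. Differentiability of all coefficients in x is
  derived from this.\<close>

locale sqrt_branch =
  fixes U :: "(real^'n) set" and \<mu> :: complex and f :: "real^'n \<Rightarrow> complex \<Rightarrow> complex"
  assumes open_U: "open U"
    and ne: "x \<in> U \<Longrightarrow> complex_of_real (x $ a) \<noteq> \<mu>"
    and branch: "x \<in> U \<Longrightarrow> \<exists>r>0. f x holomorphic_on ball \<mu> r \<and>
           (\<forall>t\<in>ball \<mu> r. (f x t)^2 = (\<Prod>a\<in>UNIV. t - of_real (x $ a)))"
    and cont: "continuous_on U (\<lambda>x. f x \<mu>)"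
begin

definition y :: "real^'n \<Rightarrow> complex fps" where "y x = fps_expansion (f x) \<mu>"

definition E :: "'n \<Rightarrow> real^'n \<Rightarrow> complex fps" where "E a x = recip_X \<mu> (complex_of_real (x $ a))"

lemma y_nth_0: "fps_nth (y x) 0 = f x \<mu>"
  by (simp add: y_def fps_expansion_def)

lemma y_mult_self:
  assumes x: "x \<in> U"
  shows "y x * y x = (\<Prod>a\<in>UNIV. shifted_X \<mu> (complex_of_real (x $ a)))"
proof -
  obtain r where r: "r > 0" and holo: "f x holomorphic_on ball \<mu> r"
    and sq: "\<forall>t\<in>ball \<mu> r. (f x t)^2 = (\<Prod>a\<in>UNIV. t - of_real (x $ a))"
    using branch[OF x] by blast
  have "f x analytic_on {\<mu>}"
    using r holo by (auto simp: analytic_at intro!: exI[of _ "ball \<mu> r"])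
  then have f: "(\<lambda>z. f x (\<mu> + z)) has_fps_expansion y x"
    unfolding y_def by (rule analytic_at_imp_has_fps_expansion)
  have 1: "(\<lambda>z. \<Prod>a\<in>UNIV. (\<mu> - of_real (x $ a)) + z) has_fps_expansion
     (\<Prod>a\<in>UNIV. shifted_X \<mu> (complex_of_real (x $ a)))"
    unfolding shifted_X_def by (intro fps_expansion_intros)
  have 2: "eventually (\<lambda>z. f x (\<mu> + z) * f x (\<mu> + z) = (\<Prod>a\<in>UNIV. (\<mu> - of_real (x $ a)) + z)) (nhds 0)"
  proof -
    have "eventually (\<lambda>z. z \<in> ball 0 r) (nhds 0)"
      using r by (intro eventually_nhds_in_open) auto
    then show ?thesis
    proof eventually_elim
      case (elim z)
      then have "\<mu> + z \<in> ball \<mu> r" by (simp add: dist_norm)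
      with sq have "(f x (\<mu> + z))^2 = (\<Prod>a\<in>UNIV. \<mu> + z - of_real (x $ a))" by blast
      then show ?case by (simp add: power2_eq_square algebra_simps)
    qed
  qed
  have "(\<lambda>z. f x (\<mu> + z) * f x (\<mu> + z)) has_fps_expansion
     (\<Prod>a\<in>UNIV. shifted_X \<mu> (complex_of_real (x $ a)))"
    by (rule has_fps_expansion_cong[THEN iffD2, OF 2 refl 1])
  with has_fps_expansion_mult[OF f f] show ?thesis
    by (rule fps_expansion_unique_complex)
qed

lemma y_nth_0_ne: "x \<in> U \<Longrightarrow> fps_nth (y x) 0 \<noteq> 0"
proof -
  assume x: "x \<in> U"
  have "fps_nth (y x * y x) 0 \<noteq> 0"
    unfolding y_mult_self[OF x] using ne[OF x] by (auto simp: fps_nth_prod_0 shifted_X_def)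
  then show ?thesis by auto
qed

lemma has_fps_pd_prod_shifted:
  fixes x :: "real^'n"
  shows
  "has_fps_pd (\<lambda>x. \<Prod>a\<in>UNIV. shifted_X \<mu> (complex_of_real (x $ a))) i x
     (- (\<Prod>a\<in>UNIV - {i}. shifted_X \<mu> (complex_of_real (x $ a))))"
proof -
  have *: "has_fps_pd (\<lambda>x. \<Prod>a\<in>S. shifted_X \<mu> (complex_of_real (x $ a))) i x 0" if "i \<notin> S" for S :: "'n set"
    using that
  proof (induction S rule: infinite_finite_induct)
    case (insert a S)
    then have "has_fps_pd (\<lambda>x. shifted_X \<mu> (complex_of_real (x $ a)) * (\<Prod>a\<in>S. shifted_X \<mu> (complex_of_real (x $ a)))) i x
      (shifted_X \<mu> (complex_of_real (x $ a)) * 0 + (- fps_const (of_bool (a = i))) * (\<Prod>a\<in>S. shifted_X \<mu> (complex_of_real (x $ a))))"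
      by (intro has_fps_pd_mult has_fps_pd_shifted_X) auto
    with insert show ?case by auto
  qed (auto simp: has_fps_pd_const)
  have "has_fps_pd (\<lambda>x. shifted_X \<mu> (complex_of_real (x $ i)) * (\<Prod>a\<in>UNIV - {i}. shifted_X \<mu> (complex_of_real (x $ a)))) i x
      (shifted_X \<mu> (complex_of_real (x $ i)) * 0 + (- fps_const (of_bool (i = i))) * (\<Prod>a\<in>UNIV - {i}. shifted_X \<mu> (complex_of_real (x $ a))))"
    by (intro has_fps_pd_mult has_fps_pd_shifted_X *) auto
  then show ?thesis by (simp add: prod.remove[of UNIV i])
qed

text \<open>The constant coefficient is a continuous square root. For r > 0 the coefficient of index
  r of y * y = D contains y_r only in 2 y_0 y_r, so y_r is a rational expression in D_r and lower
  coefficients with denominator 2 y_0 \<noteq> 0.\<close>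

lemma y_has_some_pd:
  assumes x: "x \<in> U"
  shows "\<exists>D. has_pd (\<lambda>x. fps_nth (y x) r) i x D"
proof (induction r rule: less_induct)
  case (less r)
  define D where "D x = (\<Prod>a\<in>UNIV. shifted_X \<mu> (complex_of_real (x $ a)))" for x :: "real^'n"
  have D: "has_pd (\<lambda>x. fps_nth (D x) r) i x (fps_nth (- (\<Prod>a\<in>UNIV - {i}. shifted_X \<mu> (complex_of_real (x $ a)))) r)" for r
    using has_fps_pd_prod_shifted[of i x] unfolding has_fps_pd_def D_def by blast
  show ?case
  proof (cases "r = 0")
    case True
    have "has_pd (\<lambda>x. fps_nth (y x) 0) i x (fps_nth (- (\<Prod>a\<in>UNIV - {i}. shifted_X \<mu> (complex_of_real (x $ a)))) 0 / (2 * fps_nth (y x) 0))"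
    proof (rule has_pd_sqrt[where h = "\<lambda>x. fps_nth (y x) 0" and f = "\<lambda>x. fps_nth (D x) 0", OF open_U x _ _ D[of 0] y_nth_0_ne[OF x]])
      show "continuous_on U (\<lambda>x. fps_nth (y x) 0)"
        using cont by (simp add: y_nth_0)
      show "fps_nth (y z) 0 * fps_nth (y z) 0 = fps_nth (D z) 0" if "z \<in> U" for z
        using y_mult_self[OF that] by (simp add: D_def flip: fps_mult_nth_0)
    qed
    with True show ?thesis by blast
  next
    case False
    obtain d where d: "\<And>j. j < r \<Longrightarrow> has_pd (\<lambda>x. fps_nth (y x) j) i x (d j)"
      using less by metis
    define N where "N x = fps_nth (D x) r - (\<Sum>j\<in>{1..<r}. fps_nth (y x) j * fps_nth (y x) (r - j))" for x
    have 1: "\<exists>d. has_pd N i x d"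
      unfolding N_def
      by (rule exI, (rule has_pd_diff D has_pd_sum has_pd_mult d | force)+)
    then obtain e where e: "has_pd N i x e" by blast
    have 2: "\<exists>d. has_pd (\<lambda>x. N x / (2 * fps_nth (y x) 0)) i x d"
      using False y_nth_0_ne[OF x] by - (rule exI, (rule has_pd_divide e has_pd_cmult d | force)+)
    have 3: "N z / (2 * fps_nth (y z) 0) = fps_nth (y z) r" if z: "z \<in> U" for z
    proof -
      have "fps_nth (D z) r = (\<Sum>j\<in>{0..r}. fps_nth (y z) j * fps_nth (y z) (r - j))"
        using y_mult_self[OF z] by (simp add: D_def fps_mult_nth flip: y_mult_self[OF z])
      also have "{0..r} = insert 0 (insert r {1..<r})" using False by auto
      also have "(\<Sum>j\<in>insert 0 (insert r {1..<r}). fps_nth (y z) j * fps_nth (y z) (r - j)) =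
         2 * fps_nth (y z) 0 * fps_nth (y z) r + (\<Sum>j\<in>{1..<r}. fps_nth (y z) j * fps_nth (y z) (r - j))"
        using False by simp
      finally have "N z = 2 * fps_nth (y z) 0 * fps_nth (y z) r" by (simp add: N_def)
      with y_nth_0_ne[OF z] show ?thesis by simp
    qed
    from 2 obtain d' where "has_pd (\<lambda>x. N x / (2 * fps_nth (y x) 0)) i x d'" by blast
    from has_pd_transform[OF open_U x 3 this] show ?thesis by blast
  qed
qed

lemma E_mult: "x \<in> U \<Longrightarrow> E a x * shifted_X \<mu> (complex_of_real (x $ a)) = 1"
  unfolding E_def using ne by (intro recip_X_mult) metis

text \<open>Differentiating y * y = D gives 2 y \<partial>_i y = - D E_i = - y * y * E_i, and y can
  be cancelled.\<close>

lemma has_fps_pd_y: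
  assumes x: "x \<in> U"
  shows "has_fps_pd y i x (fps_const (- 1 / 2) * (y x * E i x))"
proof -
  obtain d where "\<And>r. has_pd (\<lambda>x. fps_nth (y x) r) i x (d r)"
    using y_has_some_pd[OF x, of _ i] by metis
  then have d: "has_fps_pd y i x (Abs_fps d)" by (simp add: has_fps_pd_def)
  define P where "P = (\<Prod>a\<in>UNIV - {i}. shifted_X \<mu> (complex_of_real (x $ a)))"
  have "has_fps_pd (\<lambda>x. y x * y x) i x (- P)"
    unfolding P_def by (rule has_fps_pd_transform[OF open_U x y_mult_self[symmetric] has_fps_pd_prod_shifted])
  then have "y x * Abs_fps d + Abs_fps d * y x = - P"
    by (rule has_fps_pd_unique[OF has_fps_pd_mult[OF d d]])
  also have "P = y x * y x * E i x"
    unfolding y_mult_self[OF x] P_def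
    by (subst prod.remove[of UNIV i]) (use E_mult[OF x, of i] in \<open>simp_all add: mult_ac\<close>)
  finally have "y x * (Abs_fps d + Abs_fps d) = y x * (- (y x * E i x))"
    by (simp add: algebra_simps)
  moreover have "y x \<noteq> 0" using y_nth_0_ne[OF x] by auto
  ultimately have "Abs_fps d + Abs_fps d = - (y x * E i x)"
    using mult_left_cancel by blast
  from fps_half_unique[OF this] have "Abs_fps d = fps_const (- 1 / 2) * (y x * E i x)"
    unfolding fps_half_simps by (simp only: mult_minus_left mult_minus_right)
  with d show ?thesis by (simp only:)
qed

lemma has_fps_pd_E:
  assumes x: "x \<in> U"
  shows "has_fps_pd (E a) i x (fps_const (of_bool (a = i)) * E a x ^ 2)"
  using has_fps_pd_recip_X[OF ne[OF x], of a i] unfolding E_def[abs_def] .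

text \<open>The second derivative \<partial>_a \<partial>_b y, with one formula for both cases; for
  a = b it collapses to - y E_a^2 / 4.\<close>

definition H :: "'n \<Rightarrow> 'n \<Rightarrow> real^'n \<Rightarrow> complex fps" where
  "H a b x = fps_const (1 / 4) * (y x * (E a x * E b x)) + fps_const (- of_bool (a = b) / 2) * (y x * (E b x * E b x))"

lemma has_fps_pd_yE:
  assumes x: "x \<in> U"
  shows "has_fps_pd (\<lambda>x. fps_const (- 1 / 2) * (y x * E b x)) a x (H a b x)"
proof -
  have "has_fps_pd (\<lambda>x. fps_const (- 1 / 2) * (y x * E b x)) a x
     (fps_const (- 1 / 2) * (y x * (fps_const (of_bool (b = a)) * E b x ^ 2) + (fps_const (- 1 / 2) * (y x * E a x)) * E b x))"
    by (intro has_fps_pd_cmult has_fps_pd_mult has_fps_pd_y has_fps_pd_E x)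
  also have "fps_const (- 1 / 2) * (y x * (fps_const (of_bool (b = a)) * E b x ^ 2) + (fps_const (- 1 / 2) * (y x * E a x)) * E b x) = H a b x"
    unfolding H_def fps_half_simps
    by (cases "a = b") (simp_all add: algebra_simps power2_eq_square fps_half_add)
  finally show ?thesis .
qed

text \<open>Existence and commutation of \<partial>_c and \<partial>_a on \<partial>_b y, read off
  from explicit third derivatives. This is the input of the integrability argument.\<close>

lemma has_pd_H_symmetric:
  assumes x: "x \<in> U"
  shows "\<exists>D. has_pd (\<lambda>x. fps_nth (H a b x) r) c x D \<and> has_pd (\<lambda>x. fps_nth (H c b x) r) a x D"
proof -
  define T where "T c a = fps_const (1 / 4) * (y x * (E a x * (fps_const (of_bool (b = c)) * E b x ^ 2)
         + (fps_const (of_bool (a = c)) * E a x ^ 2) * E b x) + (fps_const (- 1 / 2) * (y x * E c x)) * (E a x * E b x))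
     + fps_const (- of_bool (a = b) / 2) * (y x * (E b x * (fps_const (of_bool (b = c)) * E b x ^ 2)
         + (fps_const (of_bool (b = c)) * E b x ^ 2) * E b x) + (fps_const (- 1 / 2) * (y x * E c x)) * (E b x * E b x))"
    for c a
  have "has_fps_pd (H a b) c x (T c a)" for a c
    unfolding H_def[abs_def] T_def
    by (intro has_fps_pd_add has_fps_pd_cmult has_fps_pd_mult has_fps_pd_y has_fps_pd_E x)
  moreover have "T c a = T a c"
  proof (cases "a = c")
    case False
    then show ?thesis
      unfolding T_def fps_half_simps
      by (cases "a = b"; cases "b = c") (auto simp: algebra_simps power2_eq_square fps_half_add)
  qed simp
  ultimately show ?thesis unfolding has_fps_pd_def by metis
qed

lemma pd_Y: "x \<in> U \<Longrightarrow> pd b (\<lambda>x. fps_nth (y x) r) x = - (1 / 2) * fps_nth (y x * E b x) r"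
  using has_fps_pd_y[of x b] unfolding has_fps_pd_def by (simp add: pd_eqI)

lemma has_pd_Y: "x \<in> U \<Longrightarrow> has_pd (\<lambda>x. fps_nth (y x) r) b x (pd b (\<lambda>x. fps_nth (y x) r) x)"
  using has_fps_pd_y[of x b] unfolding has_fps_pd_def by (metis pd_eqI)

lemma has_pd_pd_Y:
  assumes x: "x \<in> U"
  shows "has_pd (pd b (\<lambda>x. fps_nth (y x) r)) a x (fps_nth (H a b x) r)"
proof (rule has_pd_transform[OF open_U x])
  show "has_pd (\<lambda>x. fps_nth (fps_const (- 1 / 2) * (y x * E b x)) r) a x (fps_nth (H a b x) r)"
    using has_fps_pd_yE[OF x] unfolding has_fps_pd_def by blast
qed (simp add: pd_Y)

end

section \<open>Curvature and the Levi-Civita connection\<close>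

lemma matrix_inv_mult:
  fixes A :: "'a::field^'n^'n"
  assumes "invertible A"
  shows "A ** matrix_inv A = mat 1" "matrix_inv A ** A = mat 1"
  using assms someI_ex[of "\<lambda>A'. A ** A' = mat 1 \<and> A' ** A = mat 1"]
  unfolding invertible_def matrix_inv_def by blast+

lemma matrix_inv_eqI:
  fixes A :: "'a::field^'n^'n"
  assumes "A ** B = mat 1" "B ** A = mat 1"
  shows "matrix_inv A = B"
proof -
  have "invertible A" using assms unfolding invertible_def by blast
  then have "matrix_inv A = matrix_inv A ** (A ** B)"
    by (simp add: assms(1) matrix_mul_rid)
  also have "\<dots> = B"
    by (simp add: matrix_mul_assoc matrix_inv_mult \<open>invertible A\<close> matrix_mul_lid)
  finally show ?thesis .
qed

lemma christoffel_lower: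
  assumes inv: "invertible (G x)"
  shows "(\<Sum>f\<in>UNIV. gcov G c f x * christoffel G f a b x) =
    (1/2) * (pd a (gcov G c b) x + pd b (gcov G c a) x - pd c (gcov G a b) x)"
proof -
  define B where "B d = pd a (gcov G d b) x + pd b (gcov G d a) x - pd d (gcov G a b) x" for d
  have "(\<Sum>f\<in>UNIV. gcov G c f x * christoffel G f a b x) =
     (\<Sum>f\<in>UNIV. \<Sum>d\<in>UNIV. (1/2) * (gcov G c f x * G x $ f $ d) * B d)"
    by (simp add: christoffel_def B_def sum_distrib_left mult_ac)
  also have "\<dots> = (\<Sum>d\<in>UNIV. (1/2) * (matrix_inv (G x) ** G x) $ c $ d * B d)"
    by (subst sum.swap) (simp add: matrix_matrix_mult_def gcov_def sum_distrib_left sum_distrib_right)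
  also have "\<dots> = (\<Sum>d\<in>UNIV. if d = c then (1/2) * B d else 0)"
    by (intro sum.cong) (auto simp: matrix_inv_mult(2)[OF inv] mat_def)
  finally show ?thesis by (simp add: B_def)
qed

text \<open>This is the integrability condition of the overdetermined system \<open>\<nabla>\<nabla>Y + K Y g = 0\<close>.\<close>

lemma const_curvature_of_flat_coordinates:
  fixes U :: "(real^'n::finite) set"
  assumes U: "open U"
    and inv: "\<And>x. x \<in> U \<Longrightarrow> invertible (G x)"
    and sym: "\<And>x a b. x \<in> U \<Longrightarrow> gcov G a b x = gcov G b a x"
    and dg: "\<And>x a b i. x \<in> U \<Longrightarrow> \<exists>D. has_pd (gcov G a b) i x D"
    and dc: "\<And>x a b c i. x \<in> U \<Longrightarrow> \<exists>D. has_pd (christoffel G c a b) i x D"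
    and dY: "\<And>Y x a. Y \<in> F \<Longrightarrow> x \<in> U \<Longrightarrow> \<exists>D. has_pd Y a x D"
    and ddY: "\<And>Y x a b. Y \<in> F \<Longrightarrow> x \<in> U \<Longrightarrow> \<exists>D. has_pd (pd b Y) a x D"
    and dddY: "\<And>Y x a b c. Y \<in> F \<Longrightarrow> x \<in> U \<Longrightarrow>
       \<exists>D. has_pd (pd a (pd b Y)) c x D \<and> has_pd (pd c (pd b Y)) a x D"
    and hess: "\<And>Y x a b. Y \<in> F \<Longrightarrow> x \<in> U \<Longrightarrow> hess G Y a b x + K * Y x * gcov G a b x = 0"
    and span: "\<And>x V. x \<in> U \<Longrightarrow> (\<And>Y. Y \<in> F \<Longrightarrow> (\<Sum>e\<in>UNIV. V e * pd e Y x) = 0) \<Longrightarrow> (\<And>e. V e = 0)"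
  shows "const_curvature U G K"
  unfolding const_curvature_def
proof (intro ballI conjI allI)
  fix x assume x: "x \<in> U"
  show "invertible (G x)" by (rule inv[OF x])
  \<comment> \<open>Here \<open>e0\<close> is the upper index of the curvature tensor and
    \<open>a\<close> its last lower one.\<close>
  fix e0 b c a
  define \<Gamma> where "\<Gamma> = christoffel G"
  define g where "g = gcov G"
  \<comment> \<open>The deviation from constant curvature, as a vector in its upper index. It will
    be shown to annihilate every dY, and the spanning hypothesis then makes it zero.\<close>
  define V where "V e = riemann G e b c a x - K * ((if e = c then 1 else 0) * g a b x - (if e = a then 1 else 0) * g c b x)" for e
  have "V e0 = 0"
  proof (rule span[OF x])
    fix Y assume Y: "Y \<in> F"
    have second: "pd a (pd b Y) z = (\<Sum>f\<in>UNIV. \<Gamma> f a b z * pd f Y z) - K * (Y z * g a b z)" if "z \<in> U" for z a b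
      using hess[OF Y that, of a b] by (simp add: hess_def \<Gamma>_def g_def algebra_simps)
    have D1: "has_pd (\<Gamma> f a b) c x (pd c (\<Gamma> f a b) x)" for f a b c
      unfolding \<Gamma>_def by (rule has_pd_pd[OF dc[OF x]])
    have D2: "has_pd (g a b) c x (pd c (g a b) x)" for a b c
      unfolding g_def by (rule has_pd_pd[OF dg[OF x]])
    have D3: "has_pd Y c x (pd c Y x)" for c
      by (rule has_pd_pd[OF dY[OF Y x]])
    have D4: "has_pd (pd f Y) c x (pd c (pd f Y) x)" for f c
      by (rule has_pd_pd[OF ddY[OF Y x]])
    have third: "has_pd (pd a (pd b Y)) c x
       ((\<Sum>f\<in>UNIV. \<Gamma> f a b x * pd c (pd f Y) x + pd c (\<Gamma> f a b) x * pd f Y x)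
         - K * (Y x * pd c (g a b) x + pd c Y x * g a b x))" for a b c
      by (rule has_pd_transform[OF U x second[symmetric]], assumption)
         (intro has_pd_diff has_pd_sum has_pd_mult has_pd_cmult D1 D2 D3 D4)
    have sym3: "(\<Sum>f\<in>UNIV. \<Gamma> f a b x * pd c (pd f Y) x + pd c (\<Gamma> f a b) x * pd f Y x)
         - K * (Y x * pd c (g a b) x + pd c Y x * g a b x)
       = (\<Sum>f\<in>UNIV. \<Gamma> f c b x * pd a (pd f Y) x + pd a (\<Gamma> f c b) x * pd f Y x)
         - K * (Y x * pd a (g c b) x + pd a Y x * g c b x)"
    proof -
      obtain D where D: "has_pd (pd a (pd b Y)) c x D" "has_pd (pd c (pd b Y)) a x D"
        using dddY[OF Y x] by blast
      show ?thesis
        using has_pd_unique[OF third D(1)] has_pd_unique[OF third D(2)] by (simp only:)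
    qed
    \<comment> \<open>The Hessian equation is inserted a second time, leaving only Y and its first
      derivatives; the coefficient of Y is a Christoffel symbol of the first kind.\<close>
    have expand: "(\<Sum>f\<in>UNIV. \<Gamma> f a b x * pd c (pd f Y) x + pd c (\<Gamma> f a b) x * pd f Y x) =
       (\<Sum>e\<in>UNIV. (\<Sum>f\<in>UNIV. \<Gamma> e c f x * \<Gamma> f a b x) * pd e Y x) + (\<Sum>e\<in>UNIV. pd c (\<Gamma> e a b) x * pd e Y x)
        - K * Y x * (\<Sum>f\<in>UNIV. g c f x * \<Gamma> f a b x)" for a c
    proof -
      have "(\<Sum>f\<in>UNIV. \<Gamma> f a b x * pd c (pd f Y) x) =
         (\<Sum>f\<in>UNIV. \<Sum>e\<in>UNIV. \<Gamma> e c f x * \<Gamma> f a b x * pd e Y x) - K * Y x * (\<Sum>f\<in>UNIV. g c f x * \<Gamma> f a b x)"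
        by (simp add: second[OF x] right_diff_distrib sum_subtractf sum_distrib_left mult_ac)
      also have "(\<Sum>f\<in>UNIV. \<Sum>e\<in>UNIV. \<Gamma> e c f x * \<Gamma> f a b x * pd e Y x) =
         (\<Sum>e\<in>UNIV. (\<Sum>f\<in>UNIV. \<Gamma> e c f x * \<Gamma> f a b x) * pd e Y x)"
        by (subst sum.swap) (simp add: sum_distrib_right)
      finally show ?thesis by (simp add: sum.distrib)
    qed
    \<comment> \<open>This cancels every term proportional to Y itself against the derivatives of g,
      so that only terms in dY survive.\<close>
    have low: "(\<Sum>f\<in>UNIV. g c f x * \<Gamma> f a b x) - (\<Sum>f\<in>UNIV. g a f x * \<Gamma> f c b x) = pd a (g c b) x - pd c (g a b) x"
    proof -
      have "pd b (g a c) x = pd b (g c a) x"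
        by (rule pd_cong[OF U x]) (simp add: g_def sym)
      then show ?thesis
        unfolding g_def \<Gamma>_def christoffel_lower[where G = G and x = x, OF inv[OF x]] by (simp add: algebra_simps)
    qed
    have R: "riemann G e b c a x = pd c (\<Gamma> e a b) x - pd a (\<Gamma> e c b) x
        + ((\<Sum>f\<in>UNIV. \<Gamma> e c f x * \<Gamma> f a b x) - (\<Sum>f\<in>UNIV. \<Gamma> e a f x * \<Gamma> f c b x))" for e
      by (simp add: riemann_def \<Gamma>_def sum_subtractf)
    have "(\<Sum>e\<in>UNIV. riemann G e b c a x * pd e Y x) =
       ((\<Sum>e\<in>UNIV. (\<Sum>f\<in>UNIV. \<Gamma> e c f x * \<Gamma> f a b x) * pd e Y x) + (\<Sum>e\<in>UNIV. pd c (\<Gamma> e a b) x * pd e Y x))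
       - ((\<Sum>e\<in>UNIV. (\<Sum>f\<in>UNIV. \<Gamma> e a f x * \<Gamma> f c b x) * pd e Y x) + (\<Sum>e\<in>UNIV. pd a (\<Gamma> e c b) x * pd e Y x))"
      unfolding R by (simp add: algebra_simps sum.distrib sum_subtractf)
    also have "\<dots> = K * (pd c Y x * g a b x - pd a Y x * g c b x)
        + K * Y x * ((\<Sum>f\<in>UNIV. g c f x * \<Gamma> f a b x) - (\<Sum>f\<in>UNIV. g a f x * \<Gamma> f c b x)
            - (pd a (g c b) x - pd c (g a b) x))"
      using sym3 unfolding expand by (simp add: algebra_simps)
    also have "\<dots> = K * (pd c Y x * g a b x - pd a Y x * g c b x)"
      unfolding low by simp
    also have "\<dots> = (\<Sum>e\<in>UNIV. K * ((if e = c then 1 else 0) * g a b x - (if e = a then 1 else 0) * g c b x) * pd e Y x)"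
    proof -
      have "(\<Sum>e\<in>UNIV. K * ((if e = c then 1 else 0) * g a b x - (if e = a then 1 else 0) * g c b x) * pd e Y x) =
         (\<Sum>e\<in>UNIV. (if e = c then K * g a b x * pd e Y x else 0) - (if e = a then K * g c b x * pd e Y x else 0))"
        by (intro sum.cong) (auto simp: algebra_simps)
      then show ?thesis by (simp add: sum_subtractf algebra_simps)
    qed
    finally show "(\<Sum>e\<in>UNIV. V e * pd e Y x) = 0"
      by (simp add: V_def left_diff_distrib sum_subtractf)
  qed
  then show "riemann G e0 b c a x = K * ((if e0 = c then 1 else 0) * gcov G a b x - (if e0 = a then 1 else 0) * gcov G c b x)"
    by (simp add: V_def g_def)
qed

section \<open>The Levi-Civita connection of the diagonal metric\<close>

locale lc_metric =
  fixes U :: "(real^'n::finite) set" and p :: "complex poly"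
  assumes open_U: "open U"
    and distinct: "x \<in> U \<Longrightarrow> a \<noteq> b \<Longrightarrow> x $ a \<noteq> x $ b"
    and p_ne: "x \<in> U \<Longrightarrow> poly p (of_real (x $ a)) \<noteq> 0"
begin

abbreviation G :: "real^'n \<Rightarrow> complex^'n^'n" where "G \<equiv> gLC_P (poly p)"

definition \<Delta> :: "'n \<Rightarrow> real^'n \<Rightarrow> complex" where
  "\<Delta> a x = (\<Prod>j\<in>UNIV - {a}. of_real (x $ a) - of_real (x $ j))"

definition w :: "'n \<Rightarrow> real^'n \<Rightarrow> complex" where "w a x = poly p (of_real (x $ a)) / \<Delta> a x"

definition g :: "'n \<Rightarrow> real^'n \<Rightarrow> complex" where "g a x = \<Delta> a x / poly p (of_real (x $ a))"

text \<open>On U this is \<partial>_e log g_aa: the sum comes from the product of differences, the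
  last term from p. For a \<noteq> e it does not involve p.\<close>

definition M :: "'n \<Rightarrow> 'n \<Rightarrow> real^'n \<Rightarrow> complex" where
  "M a e x = (\<Sum>j\<in>UNIV - {a}. (of_bool (a = e) - of_bool (j = e)) / (of_real (x $ a) - of_real (x $ j)))
     - of_bool (a = e) * (poly (pderiv p) (of_real (x $ a)) / poly p (of_real (x $ a)))"

lemma diff_ne: "x \<in> U \<Longrightarrow> a \<noteq> b \<Longrightarrow> complex_of_real (x $ a) - of_real (x $ b) \<noteq> 0"
  using distinct by simp

lemma \<Delta>_ne: "x \<in> U \<Longrightarrow> \<Delta> a x \<noteq> 0"
  using distinct by (auto simp: \<Delta>_def)

lemma w_g: "x \<in> U \<Longrightarrow> w a x * g a x = 1"
  using \<Delta>_ne p_ne by (simp add: w_def g_def)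

lemma G_nth: "G x $ a $ b = (if a = b then w a x else 0)"
  by (simp add: gLC_P_def w_def \<Delta>_def)

lemma G_inverse:
  assumes x: "x \<in> U"
  shows "G x ** (\<chi> a b. if a = b then g a x else 0) = mat 1"
    "(\<chi> a b. if a = b then g a x else 0) ** G x = mat 1"
proof -
  have *: "(\<Sum>k\<in>UNIV. (if a = k then u a else 0) * (if k = b then v k else 0)) = (if a = b then u a * v a else (0::complex))"
    for a b :: 'n and u v
  proof -
    have *: "(\<Sum>k\<in>UNIV. (if a = k then u a else 0) * (if k = b then v k else 0)) =
      (\<Sum>k\<in>UNIV. if k = a then (if a = b then u a * v a else 0) else 0)"
      by (intro sum.cong) auto
    then show ?thesis by simp
  qed
  show "G x ** (\<chi> a b. if a = b then g a x else 0) = mat 1"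
    "(\<chi> a b. if a = b then g a x else 0) ** G x = mat 1"
    using w_g[OF x] *[of _ "\<lambda>a. w a x" _ "\<lambda>a. g a x"] *[of _ "\<lambda>a. g a x" _ "\<lambda>a. w a x"]
    by (auto simp: matrix_matrix_mult_def mat_def vec_eq_iff G_nth mult.commute[of "g _ x"])
qed

lemma invertible_G: "x \<in> U \<Longrightarrow> invertible (G x)"
  using G_inverse unfolding invertible_def by blast

lemma gcov_G: "x \<in> U \<Longrightarrow> gcov G a b x = (if a = b then g a x else 0)"
  by (simp add: gcov_def matrix_inv_eqI[OF G_inverse])

lemma M_neq:
  assumes "a \<noteq> e"
  shows "M a e x = 1 / (of_real (x $ e) - of_real (x $ a))"
proof -
  have "(\<Sum>j\<in>UNIV - {a}. (of_bool (a = e) - of_bool (j = e)) / (of_real (x $ a) - of_real (x $ j))) =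
     (\<Sum>j\<in>UNIV - {a}. if j = e then - (1 / (complex_of_real (x $ a) - of_real (x $ e))) else 0)"
    using assms by (intro sum.cong) auto
  also have "\<dots> = 1 / (of_real (x $ e) - of_real (x $ a))"
    using assms by simp (metis minus_diff_eq minus_divide_right)
  finally show ?thesis using assms by (simp add: M_def)
qed

lemma has_pd_g:
  assumes x: "x \<in> U"
  shows "has_pd (g a) e x (g a x * M a e x)"
proof -
  have "has_pd (\<lambda>x. complex_of_real (x $ a) - of_real (x $ j)) e x
     ((of_real (x $ a) - of_real (x $ j)) * ((of_bool (a = e) - of_bool (j = e)) / (of_real (x $ a) - of_real (x $ j))))"
    if "j \<in> UNIV - {a}" for j
    using has_pd_coord_diff[of a j e x] diff_ne[OF x, of a j] that by auto
  then have D: "has_pd (\<Delta> a) e x (\<Delta> a x * (\<Sum>j\<in>UNIV - {a}. (of_bool (a = e) - of_bool (j = e)) / (of_real (x $ a) - of_real (x $ j))))"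
    unfolding \<Delta>_def[abs_def] by (rule has_pd_prod_log)
  have "has_pd (\<lambda>x. poly p (of_real (x $ a))) e x (poly (pderiv p) (of_real (x $ a)) * (if a = e then 1 else 0))"
    by (intro has_pd_poly has_pd_coord)
  from has_pd_divide[OF D this p_ne[OF x]] show ?thesis
    unfolding g_def[abs_def]
    by (rule back_subst) (use p_ne[OF x, of a] in \<open>auto simp: M_def field_simps\<close>)
qed

lemma has_pd_w:
  assumes x: "x \<in> U"
  shows "\<exists>D. has_pd (w a) e x D"
proof -
  have "has_pd (\<lambda>x. inverse (g a x)) e x (- (inverse (g a x) * (g a x * M a e x) * inverse (g a x)))"
    using w_g[OF x, of a] by (intro has_pd_inverse has_pd_g[OF x]) auto
  moreover have "inverse (g a z) = w a z" for z
    by (simp add: g_def w_def)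
  ultimately show ?thesis by auto
qed

lemma has_pd_M:
  assumes x: "x \<in> U"
  shows "\<exists>D. has_pd (M a e) i x D"
  unfolding M_def[abs_def]
  using distinct[OF x] p_ne[OF x]
  by - (rule exI, (rule has_pd_const has_pd_diff has_pd_sum has_pd_divide has_pd_coord has_pd_cmult has_pd_poly | force)+)

lemma has_pd_gcov:
  assumes x: "x \<in> U"
  shows "has_pd (gcov G a b) e x (if a = b then g a x * M a e x else 0)"
proof (rule has_pd_transform[OF open_U x])
  show "has_pd (\<lambda>x. if a = b then g a x else 0) e x (if a = b then g a x * M a e x else 0)"
    using has_pd_g[OF x] by simp
qed (simp add: gcov_G)

lemma christoffel_G:
  assumes x: "x \<in> U"
  shows "christoffel G c a b x = 1 / 2 * (of_bool (c = b) * M c a x + of_bool (c = a) * M c b x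
    - of_bool (a = b) * (w c x * g a x * M a c x))"
proof -
  have "christoffel G c a b x = 1 / 2 * (\<Sum>d\<in>UNIV. if d = c then w c x * (of_bool (c = b) * (g c x * M c a x)
      + of_bool (c = a) * (g c x * M c b x) - of_bool (a = b) * (g a x * M a c x)) else 0)"
    unfolding christoffel_def G_nth
    by (intro arg_cong[where f = "\<lambda>x. 1 / 2 * x"] sum.cong) (auto simp: pd_eqI[OF has_pd_gcov[OF x]])
  also have "\<dots> = 1 / 2 * (of_bool (c = b) * ((w c x * g c x) * M c a x)
      + of_bool (c = a) * ((w c x * g c x) * M c b x) - of_bool (a = b) * (w c x * g a x * M a c x))"
    by (simp add: algebra_simps)
  finally show ?thesis by (simp add: w_g[OF x])
qed

lemma has_pd_christoffel:
  assumes x: "x \<in> U"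
  shows "\<exists>D. has_pd (christoffel G c a b) i x D"
proof -
  have m: "has_pd (M a b) i x (pd i (M a b) x)" for a b by (rule has_pd_pd[OF has_pd_M[OF x]])
  have v: "has_pd (w a) i x (pd i (w a) x)" for a by (rule has_pd_pd[OF has_pd_w[OF x]])
  have "\<exists>D. has_pd (\<lambda>x. 1 / 2 * (of_bool (c = b) * M c a x + of_bool (c = a) * M c b x
    - of_bool (a = b) * (w c x * g a x * M a c x))) i x D"
    by (rule exI, (rule has_pd_cmult has_pd_diff has_pd_add has_pd_mult m v has_pd_g[OF x])+)
  then obtain D where D: "has_pd (\<lambda>x. 1 / 2 * (of_bool (c = b) * M c a x + of_bool (c = a) * M c b x
    - of_bool (a = b) * (w c x * g a x * M a c x))) i x D" ..
  have "has_pd (christoffel G c a b) i x D"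
    by (rule has_pd_transform[OF open_U x _ D]) (rule christoffel_G[symmetric])
  then show ?thesis ..
qed

end

section \<open>Hessians and Gram matrix\<close>

lemma pcompose_power: "pcompose (p ^ k) q = pcompose p q ^ k"
  for p q :: "'a::comm_semiring_1 poly"
  by (induction k) (simp_all add: pcompose_mult pcompose_1)

lemma linear_power_dvd_of_taylor:
  fixes p :: "'a::field_char_0 poly"
  assumes "\<And>n. n < k \<Longrightarrow> fps_nth (taylor_poly \<mu> p) n = 0"
  shows "[:- \<mu>, 1:] ^ k dvd p"
proof -
  have "monom 1 k dvd pcompose p [:\<mu>, 1:]"
    using assms by (simp add: monom_1_dvd_iff' taylor_poly_def)
  then obtain q where "pcompose p [:\<mu>, 1:] = [:0, 1:] ^ k * q"
    by (auto simp: monom_altdef elim!: dvdE)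
  then have "pcompose (pcompose p [:\<mu>, 1:]) [:- \<mu>, 1:] = pcompose ([:0, 1:] ^ k * q) [:- \<mu>, 1:]"
    by simp
  moreover have "pcompose (pcompose p [:\<mu>, 1:]) [:- \<mu>, 1:] = p"
    unfolding pcompose_assoc[symmetric] by (simp add: pcompose_pCons)
  ultimately show ?thesis
    by (simp add: pcompose_mult pcompose_power pcompose_pCons)
qed

lemma poly_eq_0_of_high_order_roots:
  fixes p :: "'a::idom poly"
  assumes inj: "inj_on \<mu> {..<m}" and dvd: "\<And>i. i < m \<Longrightarrow> [:- \<mu> i, 1:] ^ k i dvd p"
    and k_pos: "\<And>i. i < m \<Longrightarrow> k i \<ge> 1" and deg: "degree p < (\<Sum>i<m. k i)"
  shows "p = 0"
proof (rule ccontr)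
  assume p: "p \<noteq> 0"
  have k: "k i \<le> order (\<mu> i) p" if "i < m" for i
    using dvd[OF that] p by (simp add: order_divides)
  have sub: "\<mu> ` {..<m} \<subseteq> {x. poly p x = 0}"
    using k k_pos p by (fastforce simp: order_root)
  have "(\<Sum>i<m. k i) \<le> (\<Sum>i<m. order (\<mu> i) p)"
    using k by (intro sum_mono) auto
  also have "\<dots> = (\<Sum>x\<in>\<mu> ` {..<m}. order x p)"
    using inj by (simp add: sum.reindex)
  also have "\<dots> \<le> (\<Sum>x | poly p x = 0. order x p)"
    using sub p by (intro sum_mono2 poly_roots_finite) auto
  also have "\<dots> \<le> degree p"
    using sum_order_le_degree[OF p] .
  finally show False using deg by simp
qed

text \<open>The polynomial is the sum of V_e D/(t - x^e), which expands to y times the sum of V_e y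
  E_e. Up to -1/2, the coefficients of the latter sum are V applied to the dY_r, so the first k of
  them vanish.\<close>

lemma (in sqrt_branch) linear_power_dvd_of_coeffs:
  fixes x :: "real^'n"
  assumes x: "x \<in> U" and V: "\<And>r. r < k \<Longrightarrow> (\<Sum>e\<in>UNIV. V e * fps_nth (y x * E e x) r) = 0"
  shows "[:- \<mu>, 1:] ^ k dvd (\<Sum>e\<in>UNIV. smult (V e) (\<Prod>j\<in>UNIV - {e}. [:- complex_of_real (x $ j), 1:]))"
proof (rule linear_power_dvd_of_taylor)
  fix n assume n: "n < k"
  define S where "S = (\<Sum>e\<in>UNIV. fps_const (V e) * (y x * E e x))"
  have S: "fps_nth S r = 0" if "r < k" for r
    using V[OF that] by (simp add: S_def fps_sum_nth)
  have "(\<Prod>j\<in>UNIV - {e}. shifted_X \<mu> (complex_of_real (x $ j))) = y x * (y x * E e x)" for e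
  proof -
    have "y x * (y x * E e x) = (\<Prod>j\<in>UNIV. shifted_X \<mu> (complex_of_real (x $ j))) * E e x"
      by (simp add: y_mult_self[OF x, symmetric] mult.assoc)
    also have "\<dots> = (E e x * shifted_X \<mu> (complex_of_real (x $ e))) * (\<Prod>j\<in>UNIV - {e}. shifted_X \<mu> (complex_of_real (x $ j)))"
      by (subst prod.remove[of UNIV e]) (simp_all add: mult_ac)
    finally show ?thesis by (simp add: E_mult[OF x])
  qed
  then have "taylor_poly \<mu> (\<Sum>e\<in>UNIV. smult (V e) (\<Prod>j\<in>UNIV - {e}. [:- complex_of_real (x $ j), 1:])) = y x * S"
    by (simp add: taylor_poly_sum taylor_poly_smult taylor_poly_prod taylor_poly_linear S_def sum_distrib_left mult_ac)
  then show "fps_nth (taylor_poly \<mu> (\<Sum>e\<in>UNIV. smult (V e) (\<Prod>j\<in>UNIV - {e}. [:- complex_of_real (x $ j), 1:]))) n = 0"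
    using S n by (simp add: fps_mult_nth)
qed

context lc_metric
begin

lemma node_inj: "x \<in> U \<Longrightarrow> inj (\<lambda>a. complex_of_real (x $ a))"
  using distinct by (fastforce simp: inj_def)

lemma interpolation_at:
  assumes x: "x \<in> U" and deg: "degree p \<le> CARD('n) + 1"
  shows "\<exists>d. interpolation (\<lambda>a. complex_of_real (x $ a)) p d (coeff p (CARD('n) + 1)) (\<lambda>a. w a x)"
  using lagrange_remainder[OF node_inj[OF x] deg] node_inj[OF x]
  unfolding interpolation_def w_def \<Delta>_def by blast

lemma gstar_G: "gstar G Y Z x = (\<Sum>a\<in>UNIV. w a x * pd a Y x * pd a Z x)"
proof -
  have "gstar G Y Z x = (\<Sum>a\<in>UNIV. \<Sum>b\<in>UNIV. if b = a then w a x * pd a Y x * pd a Z x else 0)"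
    unfolding gstar_def G_nth by (intro sum.cong) auto
  then show ?thesis by simp
qed

end

section \<open>Hessian equation and Gram entries for the coefficients of one branch\<close>

locale lc_branch = lc_metric U p + sqrt_branch U \<mu> f
  for U :: "(real^'n::finite) set" and p \<mu> f +
  fixes k :: nat and t :: "complex fps" and e :: complex
  assumes deg: "degree p \<le> CARD('n) + 1"
    and e: "coeff p (CARD('n) + 1) = e"
    and factor: "taylor_poly \<mu> p = fps_X ^ k * t"
begin

abbreviation Y :: "nat \<Rightarrow> real^'n \<Rightarrow> complex" where "Y r \<equiv> \<lambda>x. fps_nth (y x) r"

text \<open>Holds for every coefficient: the Christoffel symbols involved do not see p, and the
  partial fraction of E_a E_b matches them exactly.\<close>

lemma hess_Y_off_diagonal:
  assumes x: "x \<in> U" and ab: "a \<noteq> b"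
  shows "hess G (Y r) a b x = 0"
proof -
  define q where "q = inverse (complex_of_real (x $ a) - of_real (x $ b))"
  have M: "M b a x = q" "M a b x = - q"
    using ab by (simp_all add: M_neq q_def inverse_eq_divide) (metis minus_diff_eq minus_divide_right)
  have "(\<Sum>c\<in>UNIV. christoffel G c a b x * pd c (Y r) x) =
     (\<Sum>c\<in>UNIV. (if c = b then - (1/4) * M b a x * fps_nth (y x * E b x) r else 0)
        + (if c = a then - (1/4) * M a b x * fps_nth (y x * E a x) r else 0))"
    using ab by (intro sum.cong) (auto simp: christoffel_G[OF x] pd_Y[OF x])
  also have "\<dots> = - (1/4) * M b a x * fps_nth (y x * E b x) r + - (1/4) * M a b x * fps_nth (y x * E a x) r"
    unfolding sum.distrib by (simp only: sum.delta finite UNIV_I if_True)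
  also have "\<dots> = (1/4) * q * (fps_nth (y x * E a x) r - fps_nth (y x * E b x) r)"
    unfolding M by (simp add: right_diff_distrib)
  finally have 1: "(\<Sum>c\<in>UNIV. christoffel G c a b x * pd c (Y r) x) = \<dots>" .
  have EE: "E a x * E b x = fps_const q * (E a x - E b x)"
    unfolding E_def q_def using ne[OF x] diff_ne[OF x ab] by (intro recip_X_partial_fraction) auto
  have "y x * (E a x * E b x) = fps_const q * (y x * E a x - y x * E b x)"
    unfolding EE by (simp add: algebra_simps)
  then have 2: "fps_nth (H a b x) r = (1/4) * q * (fps_nth (y x * E a x) r - fps_nth (y x * E b x) r)"
    using ab by (simp add: H_def)
  show ?thesis
    unfolding hess_def pd_eqI[OF has_pd_pd_Y[OF x]] 1 2 by simp
qed

text \<open>After multiplication by w_a = g^{aa}, the left-hand side is -1/4 times the coefficient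
  of index r of y (p/D) E_a, which vanishes for r < k.\<close>

lemma hess_Y_diagonal:
  assumes x: "x \<in> U" and r: "r < k"
  shows "hess G (Y r) a a x - e / 4 * Y r x * g a x = 0"
proof -
  obtain d where "interpolation (\<lambda>a. complex_of_real (x $ a)) p d e (\<lambda>a. w a x)"
    using interpolation_at[OF x deg] unfolding e by blast
  then interpret interpolation "\<lambda>a. complex_of_real (x $ a)" p d e "\<lambda>a. w a x" .
  have ne': "\<And>a. \<mu> \<noteq> complex_of_real (x $ a)" using ne[OF x] by metis
  define \<kappa> where "\<kappa> = poly (pderiv p) (of_real (x $ a)) / \<Delta> a x
     - w a x * (\<Sum>j\<in>UNIV - {a}. 1 / (complex_of_real (x $ a) - of_real (x $ j)))"
  \<comment> \<open>Identifies the simple-pole coefficient at x^a with the logarithmic derivative of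
    g_aa that enters the Christoffel symbol.\<close>
  have \<kappa>: "w a x * M a a x = - \<kappa>"
  proof -
    have "w a x * M a a x = w a x * (\<Sum>j\<in>UNIV - {a}. 1 / (complex_of_real (x $ a) - of_real (x $ j)))
       - w a x * (poly (pderiv p) (of_real (x $ a)) / poly p (of_real (x $ a)))"
      unfolding M_def right_diff_distrib by (intro arg_cong2[where f = "(-)"] arg_cong2[where f = "(*)"] sum.cong) auto
    then show ?thesis using p_ne[OF x, of a] by (simp add: \<kappa>_def w_def)
  qed
  have qE: "quot \<mu> * E a x = fps_const e + fps_const \<kappa> * E a x + fps_const (w a x) * (E a x * E a x)
     - (\<Sum>c\<in>UNIV - {a}. fps_const (w c x / (complex_of_real (x $ a) - of_real (x $ c))) * E c x)"
    using quot_recip[OF ne', of a] unfolding E_def \<kappa>_def \<Delta>_def power2_eq_square .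
  have "y x * quot \<mu> = fps_X ^ k * (t * inverse (y x))"
    by (rule root_mult_quot[OF ne' y_mult_self[OF x] factor])
  from arg_cong[OF this, of "\<lambda>f. f * E a x"]
  have "y x * (quot \<mu> * E a x) = fps_X ^ k * (t * inverse (y x) * E a x)"
    by (simp only: mult.assoc)
  then have "fps_nth (y x * (quot \<mu> * E a x)) r = 0"
    using r by (rule fps_X_power_dvd_coeff)
  also have "y x * (quot \<mu> * E a x) = fps_const e * y x + fps_const \<kappa> * (y x * E a x) + fps_const (w a x) * (y x * (E a x * E a x))
     - (\<Sum>c\<in>UNIV - {a}. fps_const (w c x / (complex_of_real (x $ a) - of_real (x $ c))) * (y x * E c x))"
    unfolding qE by (simp add: algebra_simps sum_distrib_left)
  finally have *: "e * fps_nth (y x) r + \<kappa> * fps_nth (y x * E a x) r + w a x * fps_nth (y x * (E a x * E a x)) r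
     - (\<Sum>c\<in>UNIV - {a}. w c x / (complex_of_real (x $ a) - of_real (x $ c)) * fps_nth (y x * E c x) r) = 0"
    by (simp add: fps_sum_nth)
  define \<Sigma> where "\<Sigma> = (\<Sum>c\<in>UNIV - {a}. w c x / (complex_of_real (x $ a) - of_real (x $ c)) * fps_nth (y x * E c x) r)"
  have "(\<Sum>c\<in>UNIV. christoffel G c a a x * pd c (Y r) x) =
     christoffel G a a a x * pd a (Y r) x + (\<Sum>c\<in>UNIV - {a}. christoffel G c a a x * pd c (Y r) x)"
    by (rule sum.remove) auto
  also have "christoffel G a a a x = 1 / 2 * M a a x"
    using w_g[OF x, of a] by (simp add: christoffel_G[OF x])
  also have "(\<Sum>c\<in>UNIV - {a}. christoffel G c a a x * pd c (Y r) x) = - (1 / 4) * g a x * \<Sigma>"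
    unfolding \<Sigma>_def sum_distrib_left
  proof (rule sum.cong)
    fix c assume "c \<in> UNIV - {a}"
    then have "M a c x = - (1 / (complex_of_real (x $ a) - of_real (x $ c)))" and "c \<noteq> a"
      by (auto simp: M_neq) (metis minus_diff_eq minus_divide_right)
    then show "christoffel G c a a x * pd c (Y r) x =
        - (1 / 4) * g a x * (w c x / (complex_of_real (x $ a) - of_real (x $ c)) * fps_nth (y x * E c x) r)"
      by (simp add: christoffel_G[OF x] pd_Y[OF x])
  qed simp
  finally have chr: "(\<Sum>c\<in>UNIV. christoffel G c a a x * pd c (Y r) x) =
     - (1 / 4) * (M a a x * fps_nth (y x * E a x) r + g a x * \<Sigma>)"
    by (simp add: pd_Y[OF x] algebra_simps)
  have HH: "fps_nth (H a a x) r = - (1 / 4) * fps_nth (y x * (E a x * E a x)) r"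
    by (simp add: H_def)
  have "w a x * (hess G (Y r) a a x - e / 4 * Y r x * g a x) =
     - (1 / 4) * (e * Y r x * (w a x * g a x) - (w a x * M a a x) * fps_nth (y x * E a x) r
       + w a x * fps_nth (y x * (E a x * E a x)) r - (w a x * g a x) * \<Sigma>)"
    by (simp add: hess_def pd_eqI[OF has_pd_pd_Y[OF x]] chr HH)
      (simp add: algebra_simps add_divide_distrib diff_divide_distrib)
  also have "\<dots> = 0"
    using * unfolding \<kappa> w_g[OF x] \<Sigma>_def by simp
  finally show ?thesis
    using w_g[OF x, of a] by auto
qed

lemma hess_Y:
  assumes "x \<in> U" "r < k"
  shows "hess G (Y r) a b x + (- e / 4) * Y r x * gcov G a b x = 0"
  using hess_Y_off_diagonal[OF assms(1), of a b r] hess_Y_diagonal[OF assms, of a]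
  by (cases "a = b") (simp_all add: gcov_G[OF assms(1)])

lemma gstar_same:
  assumes x: "x \<in> U" and "\<alpha> < k" "\<beta> < k"
  shows "gstar G (Y \<alpha>) (Y \<beta>) x = (e * Y \<alpha> x * Y \<beta> x - fps_nth (taylor_poly \<mu> p) (\<alpha> + \<beta> + 1)) / 4"
proof -
  obtain d where "interpolation (\<lambda>a. complex_of_real (x $ a)) p d e (\<lambda>a. w a x)"
    using interpolation_at[OF x deg] unfolding e by blast
  then interpret interpolation "\<lambda>a. complex_of_real (x $ a)" p d e "\<lambda>a. w a x" .
  have ne': "\<And>a. \<mu> \<noteq> complex_of_real (x $ a)" using ne[OF x] by metis
  have "gstar G (Y \<alpha>) (Y \<beta>) x = (\<Sum>a\<in>UNIV. w a x * fps_nth (y x * E a x) \<alpha> * fps_nth (y x * E a x) \<beta>) / 4"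
    by (simp add: gstar_G pd_Y[OF x] sum_divide_distrib)
  then show ?thesis
    unfolding E_def gram_same[OF ne' y_mult_self[OF x] factor assms(2,3)] by simp
qed

end

text \<open>Stated outside the locale because two expansion points occur; both branches share p,
  hence the same interpolation data at x.\<close>

lemma gstar_distinct:
  fixes U :: "(real^'n::finite) set"
  assumes 1: "lc_branch U p \<mu> f k t e" and 2: "lc_branch U p \<nu> h l s e"
    and "\<mu> \<noteq> \<nu>" and x: "x \<in> U" and "\<alpha> < k" "\<beta> < l"
  shows "gstar (gLC_P (poly p)) (\<lambda>x. fps_nth (fps_expansion (f x) \<mu>) \<alpha>) (\<lambda>x. fps_nth (fps_expansion (h x) \<nu>) \<beta>) x =
    e / 4 * fps_nth (fps_expansion (f x) \<mu>) \<alpha> * fps_nth (fps_expansion (h x) \<nu>) \<beta>"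
proof -
  interpret A: lc_branch U p \<mu> f k t e by fact
  interpret B: lc_branch U p \<nu> h l s e by fact
  obtain d where "interpolation (\<lambda>a. complex_of_real (x $ a)) p d e (\<lambda>a. A.w a x)"
    using A.interpolation_at[OF x A.deg] unfolding A.e by blast
  then interpret interpolation "\<lambda>a. complex_of_real (x $ a)" p d e "\<lambda>a. A.w a x" .
  have ne1: "\<And>a. \<mu> \<noteq> complex_of_real (x $ a)" using A.ne[OF x] by metis
  have ne2: "\<And>a. \<nu> \<noteq> complex_of_real (x $ a)" using B.ne[OF x] by metis
  have "gstar A.G (A.Y \<alpha>) (B.Y \<beta>) x = (\<Sum>a\<in>UNIV. A.w a x * fps_nth (A.y x * A.E a x) \<alpha> * fps_nth (B.y x * B.E a x) \<beta>) / 4"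
    by (simp add: A.gstar_G A.pd_Y[OF x] B.pd_Y[OF x] sum_divide_distrib)
  also have "\<dots> = e / 4 * A.Y \<alpha> x * B.Y \<beta> x"
    unfolding A.E_def B.E_def
      gram_distinct[OF ne1 ne2 A.y_mult_self[OF x] B.y_mult_self[OF x] A.factor B.factor assms(3,5,6)] by simp
  finally show ?thesis by (simp add: A.y_def B.y_def)
qed

text \<open>The matrix vanishes for \<alpha> + \<beta> < k - 1 and has T 0 along \<alpha> + \<beta>
  = k - 1. Row \<gamma> therefore determines c at k - 1 - \<gamma> once all entries of higher index
  are known to be 0.\<close>

lemma antitriangular_kernel:
  fixes T :: "nat \<Rightarrow> 'a::idom"
  assumes T0: "T 0 \<noteq> 0"
    and eq: "\<And>\<alpha>. \<alpha> < k \<Longrightarrow> (\<Sum>\<beta><k. c \<beta> * (if \<alpha> + \<beta> + 1 < k then 0 else T (\<alpha> + \<beta> + 1 - k))) = 0"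
    and "\<beta> < k"
  shows "c \<beta> = 0"
proof -
  have "\<gamma> < k \<Longrightarrow> c (k - 1 - \<gamma>) = 0" for \<gamma>
  proof (induction \<gamma> rule: less_induct)
    case (less \<gamma>)
    have "(\<Sum>\<beta><k. c \<beta> * (if \<gamma> + \<beta> + 1 < k then 0 else T (\<gamma> + \<beta> + 1 - k))) =
      (\<Sum>\<beta><k. if \<beta> = k - 1 - \<gamma> then c (k - 1 - \<gamma>) * T 0 else 0)"
    proof (rule sum.cong)
      fix \<beta> assume \<beta>: "\<beta> \<in> {..<k}"
      have "c \<beta> = 0" if "\<beta> > k - 1 - \<gamma>"
        using less.IH[of "k - 1 - \<beta>"] that less.prems \<beta> by auto
      then show "c \<beta> * (if \<gamma> + \<beta> + 1 < k then 0 else T (\<gamma> + \<beta> + 1 - k)) =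
         (if \<beta> = k - 1 - \<gamma> then c (k - 1 - \<gamma>) * T 0 else 0)"
        using less.prems by (cases "\<beta> > k - 1 - \<gamma>") auto
    qed simp
    also have "\<dots> = c (k - 1 - \<gamma>) * T 0"
      using less.prems by simp
    finally show ?case using eq[OF less.prems] T0 by simp
  qed
  from this[of "k - 1 - \<beta>"] show ?thesis using \<open>\<beta> < k\<close> by simp
qed

lemma tildeP_eq:
  "tildeP m \<mu> k i r = (if r < 0 then 0 else
     fps_nth (taylor_poly (\<mu> i) (\<Prod>s\<in>{..<m} - {i}. [:- \<mu> s, 1:] ^ k s)) (nat r))"
proof -
  have "(\<lambda>t. \<Prod>s\<in>{..<m} - {i}. (t - \<mu> s) ^ k s) = poly (\<Prod>s\<in>{..<m} - {i}. [:- \<mu> s, 1:] ^ k s)"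
    by (simp add: fun_eq_iff poly_prod)
  then show ?thesis
    unfolding tildeP_def fps_expansion_poly[symmetric] by (simp add: fps_expansion_def)
qed

theorem theorem1p6:
  fixes U :: "(real^'n) set"
    and K :: real
    and m :: nat
    and \<mu> :: "nat \<Rightarrow> complex"
    and k :: "nat \<Rightarrow> nat"
    and F :: "nat \<Rightarrow> real^'n \<Rightarrow> complex \<Rightarrow> complex"
  assumes K_nz: "K \<noteq> 0"
    and k_pos: "\<forall>i<m. k i \<ge> 1"
    and mu_distinct: "inj_on \<mu> {..<m}"
    and k_sum: "(\<Sum>i<m. k i) = CARD('n) + 1"
    and U_open: "open U" and U_ne: "U \<noteq> {}"
    and U_distinct: "\<forall>x\<in>U. \<forall>a b. a \<noteq> b \<longrightarrow> x $ a \<noteq> x $ b"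
    and U_mu: "\<forall>x\<in>U. \<forall>a. \<forall>i<m. of_real (x $ a) \<noteq> \<mu> i"
    and branch: "\<forall>i<m. \<forall>x\<in>U. \<exists>r>0. F i x holomorphic_on ball (\<mu> i) r \<and>
                   (\<forall>t\<in>ball (\<mu> i) r. (F i x t)^2 = (\<Prod>a\<in>UNIV. t - of_real (x $ a)))"
    and branch_cont: "\<forall>i<m. continuous_on U (\<lambda>x. F i x (\<mu> i))"
  defines "G \<equiv> gLC_P (\<lambda>t::complex. - 4 * of_real K * (\<Prod>i<m. (t - \<mu> i) ^ k i))"
    and "Y \<equiv> (\<lambda>i \<alpha> x. (deriv ^^ \<alpha>) (F i x) (\<mu> i) / of_nat (fact \<alpha>))"
  shows "const_curvature U G (of_real K)
    \<and> (\<forall>c :: nat \<Rightarrow> nat \<Rightarrow> complex.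
          (\<forall>x\<in>U. (\<Sum>i<m. \<Sum>\<alpha><k i. c i \<alpha> * Y i \<alpha> x) = 0) \<longrightarrow>
          (\<forall>i<m. \<forall>\<alpha><k i. c i \<alpha> = 0))
    \<and> (\<forall>i<m. \<forall>\<alpha><k i. \<forall>x\<in>U. \<forall>a b.
          hess G (Y i \<alpha>) a b x + of_real K * Y i \<alpha> x * gcov G a b x = 0)
    \<and> (\<forall>i<m. \<forall>j<m. \<forall>\<alpha><k i. \<forall>\<beta><k j. \<forall>x\<in>U. i \<noteq> j \<longrightarrow>
          gstar G (Y i \<alpha>) (Y j \<beta>) x = - of_real K * Y i \<alpha> x * Y j \<beta> x)
    \<and> (\<forall>i<m. \<forall>\<alpha><k i. \<forall>\<beta><k i. \<forall>x\<in>U.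
          gstar G (Y i \<alpha>) (Y i \<beta>) x = - of_real K * (Y i \<alpha> x * Y i \<beta> x
              - tildeP m \<mu> k i (int \<alpha> + int \<beta> - int (k i) + 1)))"
proof -
  define p where "p = smult (- 4 * of_real K) (\<Prod>i<m. [:- \<mu> i, 1:] ^ k i)"
  define e where "e = - 4 * complex_of_real K"
  define T where "T i = taylor_poly (\<mu> i) (\<Prod>s\<in>{..<m} - {i}. [:- \<mu> s, 1:] ^ k s)" for i
  have G: "G = gLC_P (poly p)"
    unfolding G_def p_def by (intro arg_cong[where f = gLC_P]) (simp add: fun_eq_iff poly_prod)
  have Y: "Y i \<alpha> = (\<lambda>x. fps_nth (fps_expansion (F i x) (\<mu> i)) \<alpha>)" for i \<alpha>
    by (simp add: Y_def fps_expansion_def)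
  have e0: "e \<noteq> 0" using K_nz by (simp add: e_def)
  have degprod: "degree (\<Prod>i<m. [:- \<mu> i, 1:] ^ k i) = CARD('n) + 1"
    by (subst degree_prod_eq_sum_degree) (simp_all add: degree_linear_power k_sum)
  then have deg: "degree p = CARD('n) + 1"
    using e0 by (simp add: p_def e_def)
  have "lead_coeff (\<Prod>i<m. [:- \<mu> i, 1:] ^ k i) = 1"
    by (simp add: lead_coeff_prod lead_coeff_power)
  then have coeff: "coeff p (CARD('n) + 1) = e"
    unfolding degprod by (simp add: p_def e_def)
  \<comment> \<open>\<open>T i\<close> expands the product over the other roots at \<mu>_i, so its
    coefficients are the numbers tilde P_i^(r) of the statement.\<close>
  have factor: "taylor_poly (\<mu> i) p = fps_X ^ k i * (fps_const e * T i)" if "i < m" for i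
  proof -
    have "p = smult e ([:- \<mu> i, 1:] ^ k i * (\<Prod>s\<in>{..<m} - {i}. [:- \<mu> s, 1:] ^ k s))"
      using that by (simp add: p_def e_def prod.remove)
    then show ?thesis
      by (simp add: taylor_poly_smult taylor_poly_mult taylor_poly_power taylor_poly_linear T_def shifted_X_def mult_ac)
  qed
  have br: "lc_branch U p (\<mu> i) (F i) (k i) (fps_const e * T i) e" if i: "i < m" for i
  proof unfold_locales
    show "poly p (complex_of_real (x $ a)) \<noteq> 0" if "x \<in> U" for x :: "real^'n" and a
      using that U_mu K_nz by (auto simp: p_def poly_prod)
  qed (use U_open U_distinct U_mu branch branch_cont deg coeff factor i in auto)
  have sub: "lc_metric U p"
  proof -
    have "m > 0" using k_sum by (cases m) auto
    then show ?thesis using br unfolding lc_branch_def by blast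
  qed
  interpret lc_metric U p by (rule sub)
  have hess: "hess G (Y i \<alpha>) a b x + of_real K * Y i \<alpha> x * gcov G a b x = 0"
    if "i < m" "\<alpha> < k i" "x \<in> U" for i \<alpha> a b x
  proof -
    interpret B: lc_branch U p "\<mu> i" "F i" "k i" "fps_const e * T i" e by (rule br) fact
    show ?thesis
      using B.hess_Y[OF that(3,2), of a b] by (simp add: G Y B.y_def e_def)
  qed
  have distinct: "gstar G (Y i \<alpha>) (Y j \<beta>) x = - of_real K * Y i \<alpha> x * Y j \<beta> x"
    if "i < m" "j < m" "\<alpha> < k i" "\<beta> < k j" "x \<in> U" "i \<noteq> j" for i j \<alpha> \<beta> x
    using gstar_distinct[OF br[OF that(1)] br[OF that(2)] _ that(5,3,4)] that mu_distinct
    by (auto simp: G Y e_def inj_on_def)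
  have same: "gstar G (Y i \<alpha>) (Y i \<beta>) x = - of_real K * (Y i \<alpha> x * Y i \<beta> x
       - (if \<alpha> + \<beta> + 1 < k i then 0 else fps_nth (T i) (\<alpha> + \<beta> + 1 - k i)))"
    if "i < m" "\<alpha> < k i" "\<beta> < k i" "x \<in> U" for i \<alpha> \<beta> x
  proof -
    interpret B: lc_branch U p "\<mu> i" "F i" "k i" "fps_const e * T i" e by (rule br) fact
    have tf: "fps_nth (taylor_poly (\<mu> i) p) n = - 4 * of_real K * (if n < k i then 0 else fps_nth (T i) (n - k i))" for n
      unfolding factor[OF that(1)] fps_X_power_mult_nth by (simp add: e_def)
    show ?thesis
      unfolding G Y B.gstar_same[OF that(4,2,3), unfolded B.y_def] tf e_def
      by (simp add: algebra_simps diff_divide_distrib)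
  qed
  \<comment> \<open>Reconciles the integer index, with value 0 below zero, with truncated
    subtraction on naturals guarded by the case distinction.\<close>
  have tilde: "tildeP m \<mu> k i (int \<alpha> + int \<beta> - int (k i) + 1) =
     (if \<alpha> + \<beta> + 1 < k i then 0 else fps_nth (T i) (\<alpha> + \<beta> + 1 - k i))" for i \<alpha> \<beta>
  proof -
    have "nat (int \<alpha> + int \<beta> - int (k i) + 1) = \<alpha> + \<beta> + 1 - k i" by linarith
    moreover have "int \<alpha> + int \<beta> - int (k i) + 1 < 0 \<longleftrightarrow> \<alpha> + \<beta> + 1 < k i" by linarith
    ultimately show ?thesis by (simp add: tildeP_eq T_def)
  qed
  have T0: "fps_nth (T i) 0 \<noteq> 0" if "i < m" for i
    using mu_distinct that
    by (auto simp: T_def taylor_poly_prod taylor_poly_power taylor_poly_linear fps_nth_prod_0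
        shifted_X_def fps_nth_power_0 inj_on_def)
  have pdY: "has_pd (Y i \<alpha>) a x (pd a (Y i \<alpha>) x)" if "i < m" "x \<in> U" for i \<alpha> a x
  proof -
    interpret B: lc_branch U p "\<mu> i" "F i" "k i" "fps_const e * T i" e by (rule br) fact
    show ?thesis using B.has_pd_Y[OF that(2), of \<alpha> a] by (simp add: Y B.y_def)
  qed
  have indep: "c i \<alpha> = 0"
    if c: "\<forall>x\<in>U. (\<Sum>i<m. \<Sum>\<alpha><k i. c i \<alpha> * Y i \<alpha> x) = 0" and i: "i < m" and \<alpha>: "\<alpha> < k i"
    for c :: "nat \<Rightarrow> nat \<Rightarrow> complex" and i \<alpha>
  proof -
    obtain x where x: "x \<in> U" using U_ne by blast
    \<comment> \<open>The relation holds on all of the open set U, so it may be differentiated at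
      x.\<close>
    have d0: "(\<Sum>j<m. \<Sum>\<beta><k j. c j \<beta> * pd a (Y j \<beta>) x) = 0" for a
    proof -
      have "has_pd (\<lambda>x. \<Sum>j<m. \<Sum>\<beta><k j. c j \<beta> * Y j \<beta> x) a x (\<Sum>j<m. \<Sum>\<beta><k j. c j \<beta> * pd a (Y j \<beta>) x)"
        using x by (intro has_pd_sum has_pd_cmult pdY) auto
      moreover have "has_pd (\<lambda>x. \<Sum>j<m. \<Sum>\<beta><k j. c j \<beta> * Y j \<beta> x) a x 0"
        by (rule has_pd_transform[OF U_open x _ has_pd_const[of 0]]) (use c in auto)
      ultimately show ?thesis by (rule has_pd_unique)
    qed
    have "(\<Sum>\<beta><k i. c i \<beta> * (if \<alpha> + \<beta> + 1 < k i then 0 else fps_nth (T i) (\<alpha> + \<beta> + 1 - k i))) = 0"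
      if \<alpha>: "\<alpha> < k i" for \<alpha>
    proof -
      \<comment> \<open>Adding K Y Y' to the Gram matrix costs nothing, since the relation itself
        kills that contribution at x. It makes the blocks with j \<noteq> i vanish and leaves the
        antitriangular one.\<close>
      define S where "S j \<beta> = gstar G (Y i \<alpha>) (Y j \<beta>) x + of_real K * Y i \<alpha> x * Y j \<beta> x" for j \<beta>
      have "(\<Sum>j<m. \<Sum>\<beta><k j. c j \<beta> * gstar G (Y i \<alpha>) (Y j \<beta>) x) =
         (\<Sum>j<m. \<Sum>\<beta><k j. \<Sum>a\<in>UNIV. w a x * pd a (Y i \<alpha>) x * (c j \<beta> * pd a (Y j \<beta>) x))"
        by (simp add: G gstar_G sum_distrib_left mult_ac)
      also have "\<dots> = (\<Sum>a\<in>UNIV. w a x * pd a (Y i \<alpha>) x * (\<Sum>j<m. \<Sum>\<beta><k j. c j \<beta> * pd a (Y j \<beta>) x))"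
        by (simp add: sum.swap[of _ _ UNIV] sum_distrib_left)
      also have "\<dots> = 0" by (simp add: d0)
      finally have 1: "(\<Sum>j<m. \<Sum>\<beta><k j. c j \<beta> * gstar G (Y i \<alpha>) (Y j \<beta>) x) = 0" .
      have "(\<Sum>j<m. \<Sum>\<beta><k j. c j \<beta> * (of_real K * Y i \<alpha> x * Y j \<beta> x)) =
          of_real K * Y i \<alpha> x * (\<Sum>j<m. \<Sum>\<beta><k j. c j \<beta> * Y j \<beta> x)"
        by (simp add: sum_distrib_left mult_ac)
      also have "\<dots> = 0" using c x by simp
      finally have "(\<Sum>j<m. \<Sum>\<beta><k j. c j \<beta> * S j \<beta>) = 0"
        using 1 by (simp add: S_def distrib_left sum.distrib)
      also have "(\<Sum>j<m. \<Sum>\<beta><k j. c j \<beta> * S j \<beta>) = (\<Sum>j<m. if j = i then \<Sum>\<beta><k i. c i \<beta> * S i \<beta> else 0)"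
        using distinct[OF i _ \<alpha> _ x] by (intro sum.cong) (auto simp: S_def)
      also have "\<dots> = (\<Sum>\<beta><k i. c i \<beta> * S i \<beta>)"
        using i by simp
      also have "\<dots> = of_real K * (\<Sum>\<beta><k i. c i \<beta> * (if \<alpha> + \<beta> + 1 < k i then 0 else fps_nth (T i) (\<alpha> + \<beta> + 1 - k i)))"
        unfolding sum_distrib_left
        by (intro sum.cong) (auto simp: S_def same[OF i \<alpha> _ x] algebra_simps)
      finally show ?thesis using K_nz by simp
    qed
    then show ?thesis
      by (rule antitriangular_kernel[where T = "fps_nth (T i)" and c = "c i", OF T0[OF i] _ \<alpha>])
  qed
  have curv: "const_curvature U G (of_real K)"
  proof (rule const_curvature_of_flat_coordinates[where F = "{Y i \<alpha> | i \<alpha>. i < m \<and> \<alpha> < k i}", OF U_open])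
    fix Z x assume "Z \<in> {Y i \<alpha> | i \<alpha>. i < m \<and> \<alpha> < k i}" and x: "x \<in> U"
    then obtain i \<alpha> where i: "i < m" "\<alpha> < k i" and Z: "Z = Y i \<alpha>" by blast
    interpret B: lc_branch U p "\<mu> i" "F i" "k i" "fps_const e * T i" e by (rule br) fact
    have Z': "Z = B.Y \<alpha>" by (simp add: Z Y B.y_def)
    show "\<exists>D. has_pd Z a x D" for a unfolding Z using pdY[OF i(1) x] by blast
    show "\<exists>D. has_pd (pd b Z) a x D" for a b unfolding Z' using B.has_pd_pd_Y[OF x] by blast
    show "\<exists>D. has_pd (pd a (pd b Z)) c x D \<and> has_pd (pd c (pd b Z)) a x D" for a b c
    proof -
      obtain D where D: "has_pd (\<lambda>x. fps_nth (B.H a b x) \<alpha>) c x D" "has_pd (\<lambda>x. fps_nth (B.H c b x) \<alpha>) a x D"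
        using B.has_pd_H_symmetric[OF x] by blast
      have *: "fps_nth (B.H a b z) \<alpha> = pd a (pd b Z) z" if "z \<in> U" for z a
        unfolding Z' by (rule pd_eqI[OF B.has_pd_pd_Y[OF that], symmetric])
      show ?thesis
        using has_pd_transform[OF U_open x * D(1)] has_pd_transform[OF U_open x * D(2)] by blast
    qed
    show "hess G Z a b x + of_real K * Z x * gcov G a b x = 0" for a b
      unfolding Z by (rule hess[OF i x])
  next
    fix x :: "real^'n" and V and a :: 'n
    assume x: "x \<in> U" and V: "\<And>Z. Z \<in> {Y i \<alpha> | i \<alpha>. i < m \<and> \<alpha> < k i} \<Longrightarrow> (\<Sum>e\<in>UNIV. V e * pd e Z x) = 0"
    \<comment> \<open>Divisible by every (t - \<mu>_i)^k_i, hence with n + 1 roots counted with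
      multiplicity unless it is zero, but of degree at most n - 1.\<close>
    define R where "R = (\<Sum>e\<in>UNIV. smult (V e) (\<Prod>j\<in>UNIV - {e}. [:- complex_of_real (x $ j), 1:]))"
    have "R = 0"
    proof (rule poly_eq_0_of_high_order_roots[OF mu_distinct])
      fix i assume i: "i < m"
      then show "k i \<ge> 1" using k_pos by simp
      interpret B: lc_branch U p "\<mu> i" "F i" "k i" "fps_const e * T i" e by (rule br) fact
      show "[:- \<mu> i, 1:] ^ k i dvd R"
        unfolding R_def
      proof (rule B.linear_power_dvd_of_coeffs[OF x])
        fix r assume "r < k i"
        then have "(\<Sum>e\<in>UNIV. V e * pd e (Y i r) x) = 0" using V i by blast
        moreover have "pd e (Y i r) x = - (1 / 2) * fps_nth (B.y x * B.E e x) r" for e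
          using B.pd_Y[OF x, of e r] by (simp add: Y B.y_def)
        ultimately have "- (1 / 2) * (\<Sum>e\<in>UNIV. V e * fps_nth (B.y x * B.E e x) r) = 0"
          by (simp add: sum_distrib_left mult_ac)
        then show "(\<Sum>e\<in>UNIV. V e * fps_nth (B.y x * B.E e x) r) = 0" by simp
      qed
    next
      have "degree R \<le> CARD('n) - 1"
        unfolding R_def
        by (intro degree_sum_le order.trans[OF degree_smult_le])
           (auto simp: degree_prod_eq_sum_degree card_Diff_singleton)
      then show "degree R < (\<Sum>i<m. k i)" unfolding k_sum by simp
    qed
    \<comment> \<open>At the node x^a every summand except the one omitting that factor vanishes, so
      R = 0 yields V_a = 0.\<close>
    have "poly R (of_real (x $ a)) = (\<Sum>b\<in>UNIV. if b = a then V a * \<Delta> a x else 0)"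
      unfolding R_def poly_sum
      by (intro sum.cong) (auto simp: \<Delta>_def poly_prod intro!: prod_zero)
    then show "V a = 0" using \<open>R = 0\<close> \<Delta>_ne[OF x, of a] by simp
  next
    fix x a b i assume x: "x \<in> U"
    show "gcov G a b x = gcov G b a x" by (simp add: G gcov_G[OF x])
    show "\<exists>D. has_pd (gcov G a b) i x D" unfolding G using has_pd_gcov[OF x] by blast
    show "\<exists>D. has_pd (christoffel G c a b) i x D" for c unfolding G by (rule has_pd_christoffel[OF x])
  qed (use invertible_G in \<open>simp add: G\<close>)
  show ?thesis
    unfolding tilde
    by (intro conjI curv; intro allI impI ballI) (rule indep hess distinct same; assumption)+
qed

end
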